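(* Let $m,n\ge 0$ be integers with $n\mid m/\gcd(2,m)$, and let $(A,B;D)$ be an amalgam of groups in the variety $(m,n)$. The amalgam is strongly embeddable in $(m,n)$ if and only if it is strongly embeddable in $\mathcal N_2$ and in addition $A^nA'\cap D\subseteq Z(B)$ and $B^nB'\cap D\subseteq Z(A)$.
   Context: Commutators are $[x,y]=x^{-1}y^{-1}xy$ and $[x,y,z]=[[x,y],z]$; $G'=[G,G]$; $Z(G)$ is the center. For $k>0$, $G^k$ is the subgroup generated by all $k$-th powers of elements of $G$, and $G^0=\{e\}$. Every integer divides $0$, and $0$ divides only $0$. For nonnegative integers $m,n$ with $n\mid m/\gcd(2,m)$, $(m,n)$ denotes the variety (class) of all groups satisfying the identities $x^m=[x_1,x_2]^n=[x_1,x_2,x_3]=e$. In particular $(0,0)=\mathcal N_2$ is the variety of all nilpotent groups of class at most two. An amalgam $(A,B;D)$ of groups in a class $\mathcal C$ consists of groups $A,B,D\in\mathcal C$ together with injective homomorphisms $D\to A$ and $D\to B$; $D$ is identified with its images, so it is regarded as a subgroup of both $A$ and $B$. It is strongly embeddable in $\mathcal C$ if there are $M\in\mathcal C$ and injective homomorphisms $\lambda_A\colon A\to M$, $\lambda_B\colon B\to M$ which agree on $D$ and satisfy $\lambda_A(A)\cap\lambda_B(B)=\lambda_A(D)$. *)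

theory Defs
  imports "HOL-Algebra.Generated_Groups"
begin

definition commutator :: "('a, 'x) monoid_scheme \<Rightarrow> 'a \<Rightarrow> 'a \<Rightarrow> 'a" where
  "commutator G x y = inv\<^bsub>G\<^esub> x \<otimes>\<^bsub>G\<^esub> inv\<^bsub>G\<^esub> y \<otimes>\<^bsub>G\<^esub> x \<otimes>\<^bsub>G\<^esub> y"

definition group_center :: "('a, 'x) monoid_scheme \<Rightarrow> 'a set" where
  "group_center G = {z \<in> carrier G. \<forall>x \<in> carrier G. z \<otimes>\<^bsub>G\<^esub> x = x \<otimes>\<^bsub>G\<^esub> z}"

definition power_subgroup :: "('a, 'x) monoid_scheme \<Rightarrow> nat \<Rightarrow> 'a set" where
  "power_subgroup G k =
     (if k = 0 then {\<one>\<^bsub>G\<^esub>} else generate G ((\<lambda>x. x [^]\<^bsub>G\<^esub> k) ` carrier G))"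

definition in_variety :: "nat \<Rightarrow> nat \<Rightarrow> ('a, 'x) monoid_scheme \<Rightarrow> bool" where
  "in_variety m n G \<longleftrightarrow>
     group G \<and>
     (\<forall>x \<in> carrier G. x [^]\<^bsub>G\<^esub> m = \<one>\<^bsub>G\<^esub>) \<and>
     (\<forall>x \<in> carrier G. \<forall>y \<in> carrier G. commutator G x y [^]\<^bsub>G\<^esub> n = \<one>\<^bsub>G\<^esub>) \<and>
     (\<forall>x \<in> carrier G. \<forall>y \<in> carrier G. \<forall>z \<in> carrier G.
        commutator G (commutator G x y) z = \<one>\<^bsub>G\<^esub>)"

definition in_N2 :: "('a, 'x) monoid_scheme \<Rightarrow> bool" where
  "in_N2 G \<longleftrightarrow>
     group G \<and>
     (\<forall>x \<in> carrier G. \<forall>y \<in> carrier G. \<forall>z \<in> carrier G.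
        commutator G (commutator G x y) z = \<one>\<^bsub>G\<^esub>)"

lemma in_variety_0_0: "in_variety 0 0 G \<longleftrightarrow> in_N2 G"
  by (simp add: in_variety_def in_N2_def)

text \<open>
  The identification of D with subgroups of A and of B is kept explicit: i and j are the
  two inclusions.
\<close>

definition amalgam ::
  "('a, 'x) monoid_scheme \<Rightarrow> ('b, 'y) monoid_scheme \<Rightarrow> ('d, 'z) monoid_scheme \<Rightarrow>
   ('d \<Rightarrow> 'a) \<Rightarrow> ('d \<Rightarrow> 'b) \<Rightarrow> bool" where
  "amalgam A B D i j \<longleftrightarrow>
     group A \<and> group B \<and> group D \<and>
     i \<in> hom D A \<and> inj_on i (carrier D) \<and>
     j \<in> hom D B \<and> inj_on j (carrier D)"

definition strong_embedding ::
  "('a, 'x) monoid_scheme \<Rightarrow> ('b, 'y) monoid_scheme \<Rightarrow> ('d, 'z) monoid_scheme \<Rightarrow>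
   ('d \<Rightarrow> 'a) \<Rightarrow> ('d \<Rightarrow> 'b) \<Rightarrow>
   ('c, 'w) monoid_scheme \<Rightarrow> ('a \<Rightarrow> 'c) \<Rightarrow> ('b \<Rightarrow> 'c) \<Rightarrow> bool" where
  "strong_embedding A B D i j M f g \<longleftrightarrow>
     f \<in> hom A M \<and> inj_on f (carrier A) \<and>
     g \<in> hom B M \<and> inj_on g (carrier B) \<and>
     (\<forall>d \<in> carrier D. f (i d) = g (j d)) \<and>
     f ` carrier A \<inter> g ` carrier B = f ` i ` carrier D"

text \<open>
  HOL cannot quantify existentially over the type of the elements of M, so M ranges over the
  groups whose elements are words over the disjoint union of A and B. For classes closed under
  subgroups and isomorphic copies this is no restriction, because M can be replaced by its
  subgroup generated by the images of A and B; see the lemmas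
  \<open>strongly_embeddable_varietyI\<close> and \<open>strongly_embeddable_N2I\<close> below, where
  the element type of M is arbitrary.
\<close>

definition strongly_embeddable ::
  "(('a + 'b) list monoid \<Rightarrow> bool) \<Rightarrow>
   ('a, 'x) monoid_scheme \<Rightarrow> ('b, 'y) monoid_scheme \<Rightarrow> ('d, 'z) monoid_scheme \<Rightarrow>
   ('d \<Rightarrow> 'a) \<Rightarrow> ('d \<Rightarrow> 'b) \<Rightarrow> bool" where
  "strongly_embeddable \<C> A B D i j \<longleftrightarrow>
     (\<exists>M f g. \<C> M \<and> strong_embedding A B D i j M f g)"

lemma in_variety_inj_hom:
  assumes M: "in_variety m n M" and N: "group N"
    and h: "h \<in> hom N M" and inj: "inj_on h (carrier N)"
  shows "in_variety m n N"
proof -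
  interpret N: group N by (rule N)
  have gM: "group M" using M by (simp add: in_variety_def)
  interpret h: group_hom N M h
    by (simp add: group_hom_def group_hom_axioms_def N gM h)
  have c: "commutator N x y \<in> carrier N" if "x \<in> carrier N" "y \<in> carrier N" for x y
    using that by (simp add: commutator_def)
  have hc: "h (commutator N x y) = commutator M (h x) (h y)"
    if "x \<in> carrier N" "y \<in> carrier N" for x y
    using that by (simp add: commutator_def)
  have one: "x = \<one>\<^bsub>N\<^esub>" if "x \<in> carrier N" "h x = \<one>\<^bsub>M\<^esub>" for x
    using that inj by (metis h.hom_one N.one_closed inj_onD)
  show ?thesis
    using M unfolding in_variety_def
    by (auto intro!: one N simp: c hc h.hom_nat_pow)
qed

lemma strongly_embeddable_varietyI:
  fixes M :: "('c, 'w) monoid_scheme"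
  assumes A: "group A" and B: "group B"
    and M: "in_variety m n M" and emb: "strong_embedding A B D i j M f g"
  shows "strongly_embeddable (in_variety m n) A B D i j"
proof -
  interpret M: group M using M by (simp add: in_variety_def)
  interpret A: group A by (rule A)
  interpret B: group B by (rule B)
  have fh: "f \<in> hom A M" and gh: "g \<in> hom B M"
    using emb by (auto simp: strong_embedding_def)
  have fA: "f x \<in> carrier M" if "x \<in> carrier A" for x
    using fh that by (simp add: hom_in_carrier)
  have gB: "g x \<in> carrier M" if "x \<in> carrier B" for x
    using gh that by (simp add: hom_in_carrier)
  define S where "S = f ` carrier A \<union> g ` carrier B"
  have S: "S \<subseteq> carrier M" using fA gB by (auto simp: S_def)
  define H where "H = generate M S"
  have sH: "subgroup H M" unfolding H_def by (rule M.generate_is_subgroup[OF S])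
  define L where "L = lists (Inl ` carrier A \<union> Inr ` carrier B :: (_ + _) set)"
  define ev where "ev ws = foldr (\<lambda>s a. case_sum f g s \<otimes>\<^bsub>M\<^esub> a) ws \<one>\<^bsub>M\<^esub>" for ws
  have evc: "ev ws \<in> carrier M" if "ws \<in> L" for ws
    using that unfolding L_def by (induction ws) (auto simp: ev_def fA gB)
  have ev_app: "ev (us @ ws) = ev us \<otimes>\<^bsub>M\<^esub> ev ws" if "us \<in> L" "ws \<in> L" for us ws
    using that(1)
  proof (induction us)
    case Nil
    show ?case using evc[OF that(2)] by (simp add: ev_def)
  next
    case (Cons u us)
    have us: "us \<in> L" using Cons.prems by (simp add: L_def)
    have u: "case_sum f g u \<in> carrier M" using Cons.prems by (auto simp: L_def fA gB)
    have "ev ((u # us) @ ws) = case_sum f g u \<otimes>\<^bsub>M\<^esub> ev (us @ ws)" by (simp add: ev_def)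
    also have "\<dots> = case_sum f g u \<otimes>\<^bsub>M\<^esub> (ev us \<otimes>\<^bsub>M\<^esub> ev ws)"
      using Cons.IH us by simp
    also have "\<dots> = (case_sum f g u \<otimes>\<^bsub>M\<^esub> ev us) \<otimes>\<^bsub>M\<^esub> ev ws"
      using u evc us that(2) by (simp add: M.m_assoc)
    finally show ?case by (simp add: ev_def)
  qed
  have evf: "f x \<in> ev ` L" if "x \<in> carrier A" for x
    by (rule image_eqI[of _ _ "[Inl x]"]) (use that fA in \<open>auto simp: ev_def L_def\<close>)
  have evg: "g x \<in> ev ` L" if "x \<in> carrier B" for x
    by (rule image_eqI[of _ _ "[Inr x]"]) (use that gB in \<open>auto simp: ev_def L_def\<close>)
  have sub: "x \<in> ev ` L" if "x \<in> generate M S" for x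
    using that
  proof (induction rule: generate.induct)
    case one
    show ?case by (rule image_eqI[of _ _ "[]"]) (auto simp: ev_def L_def)
  next
    case (incl h)
    then show ?case using evf evg by (auto simp: S_def)
  next
    case (inv h)
    from inv consider x where "x \<in> carrier A" "h = f x" | x where "x \<in> carrier B" "h = g x"
      by (auto simp: S_def)
    then show ?case
    proof cases
      case 1
      have "inv\<^bsub>M\<^esub> h = f (inv\<^bsub>A\<^esub> x)"
        using 1 fh A M.group_axioms
        by (simp add: group_hom.hom_inv[of A M f] group_hom_def group_hom_axioms_def)
      then show ?thesis using evf[of "inv\<^bsub>A\<^esub> x"] 1 by simp
    next
      case 2
      have "inv\<^bsub>M\<^esub> h = g (inv\<^bsub>B\<^esub> x)"
        using 2 gh B M.group_axioms
        by (simp add: group_hom.hom_inv[of B M g] group_hom_def group_hom_axioms_def)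
      then show ?thesis using evg[of "inv\<^bsub>B\<^esub> x"] 2 by simp
    qed
  next
    case (eng h1 h2)
    then obtain u v where uv: "u \<in> L" "v \<in> L" "h1 = ev u" "h2 = ev v" by auto
    have "h1 \<otimes>\<^bsub>M\<^esub> h2 = ev (u @ v)" using uv ev_app by simp
    moreover have "u @ v \<in> L" using uv by (simp add: L_def)
    ultimately show ?case by blast
  qed
  define r where "r = inv_into L ev"
  have evr: "ev (r x) = x" if "x \<in> H" for x
    using sub that by (simp add: r_def f_inv_into_f H_def)
  define N where
    "N = \<lparr>carrier = r ` H, mult = (\<lambda>x y. r (ev x \<otimes>\<^bsub>M\<^esub> ev y)), one = r \<one>\<^bsub>M\<^esub>\<rparr>"
  have cl: "x \<otimes>\<^bsub>M\<^esub> y \<in> H" if "x \<in> H" "y \<in> H" for x y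
    using that sH by (simp add: subgroup.m_closed)
  have oneH: "\<one>\<^bsub>M\<^esub> \<in> H" using sH by (simp add: subgroup.one_closed)
  have invH: "inv\<^bsub>M\<^esub> x \<in> H" if "x \<in> H" for x
    using that sH by (simp add: subgroup.m_inv_closed)
  have HM: "x \<in> carrier M" if "x \<in> H" for x
    using that sH by (meson subgroup.mem_carrier)
  have gN: "group N"
  proof (rule groupI)
    fix x assume "x \<in> carrier N"
    then obtain h where h: "h \<in> H" "x = r h" by (auto simp: N_def)
    show "\<exists>y\<in>carrier N. y \<otimes>\<^bsub>N\<^esub> x = \<one>\<^bsub>N\<^esub>"
      by (rule bexI[of _ "r (inv\<^bsub>M\<^esub> h)"]) (use h invH HM in \<open>auto simp: N_def evr\<close>)
  qed (auto simp: N_def evr cl oneH HM M.m_assoc)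
  have evh: "ev \<in> hom N M"
    by (auto simp: hom_def N_def evr cl HM)
  have evi: "inj_on ev (carrier N)"
    by (auto simp: inj_on_def N_def evr)
  have vN: "in_variety m n N"
    by (rule in_variety_inj_hom[OF M gN evh evi])
  have fH: "f x \<in> H" if "x \<in> carrier A" for x
    unfolding H_def by (rule generate.incl) (use that in \<open>auto simp: S_def\<close>)
  have gH: "g x \<in> H" if "x \<in> carrier B" for x
    unfolding H_def by (rule generate.incl) (use that in \<open>auto simp: S_def\<close>)
  have rinj: "inj_on r H" by (metis evr inj_onI)
  have "strong_embedding A B D i j N (r \<circ> f) (r \<circ> g)"
    unfolding strong_embedding_def
  proof (intro conjI)
    show "r \<circ> f \<in> hom A N"
      using fh by (auto simp: hom_def N_def evr fH)
    show "r \<circ> g \<in> hom B N"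
      using gh by (auto simp: hom_def N_def evr gH)
    show "inj_on (r \<circ> f) (carrier A)"
      using emb fH by (auto simp: strong_embedding_def intro!: comp_inj_on inj_on_subset[OF rinj])
    show "inj_on (r \<circ> g) (carrier B)"
      using emb gH by (auto simp: strong_embedding_def intro!: comp_inj_on inj_on_subset[OF rinj])
    show "\<forall>d\<in>carrier D. (r \<circ> f) (i d) = (r \<circ> g) (j d)"
      using emb by (simp add: strong_embedding_def)
    have "r ` f ` carrier A \<inter> r ` g ` carrier B = r ` (f ` carrier A \<inter> g ` carrier B)"
      using fH gH by (intro inj_on_image_Int[OF rinj, symmetric]) auto
    then show "(r \<circ> f) ` carrier A \<inter> (r \<circ> g) ` carrier B = (r \<circ> f) ` i ` carrier D"
      using emb by (simp add: strong_embedding_def image_comp)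
  qed
  with vN show ?thesis unfolding strongly_embeddable_def by blast
qed

lemma strongly_embeddable_N2I:
  fixes M :: "('c, 'w) monoid_scheme"
  assumes "group A" "group B" "in_N2 M" "strong_embedding A B D i j M f g"
  shows "strongly_embeddable in_N2 A B D i j"
  using strongly_embeddable_varietyI[of A B 0 0 M D i j f g] assms
  by (simp add: in_variety_0_0 strongly_embeddable_def)

end

theory Submission
  imports Defs "HOL-Algebra.Free_Abelian_Groups" "HOL-Algebra.Zassenhaus"
begin

text \<open>
  Necessity holds because \<open>[x\<^sup>n, y] = [x, y]\<^sup>n\<close> in a group of class two. For sufficiency, let \<open>M\<close> be a
  class-two group into which the amalgam embeds strongly, and put \<open>X = A/A'D\<close> and \<open>Y = B/B'D\<close>. The
  map \<open>\<beta>(a, b) = [a, b]\<^sup>n\<close> is bilinear on \<open>X \<times> Y\<close> with central values, and by the centrality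
  conditions it vanishes whenever one argument is killed by \<open>n\<close>. Since the \<open>n\<close>-torsion of \<open>X \<otimes> Y\<close> is
  generated by the elements \<open>x \<otimes> y\<close> with \<open>n x = 0\<close> or \<open>n y = 0\<close>, the group \<open>M\<close> embeds in a class-two
  group \<open>W\<close> with a central bilinear map \<open>\<theta>\<close> on \<open>X \<times> Y\<close> such that \<open>\<theta>\<^sup>n = \<beta>\<close>. Twisting the product of
  \<open>W \<times> X \<times> Y\<close> by \<open>\<theta>\<^sup>-\<^sup>1\<close> changes \<open>[a, b]\<close> into \<open>[a, b] \<theta>(a, b)\<^sup>-\<^sup>1\<close>, whose \<open>n\<close>-th power is trivial, and
  leaves \<open>A\<close>, \<open>B\<close> and \<open>D\<close> intact; so \<open>A\<close> and \<open>B\<close> generate a group in \<open>(m, n)\<close>.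
\<close>

section \<open>Torsion in tensor products\<close>

text \<open>Dividing \<open>M\<close> by the powers \<open>[a, b]\<^sup>n\<close> is no way out:
  \<open>M\<close> is an arbitrary class-two group, so such a power may be a nontrivial element of
  \<open>A\<close>. It has to be cancelled by a new central element that has it as
  \<open>n\<close>-th power. The quotients by \<open>A'D\<close> and \<open>B'D\<close> are natural:
  \<open>[u, b]\<close> is trivial for \<open>u\<close> in \<open>A'\<close>, and for
  \<open>d\<close> in \<open>D\<close> the commutator \<open>[d, b]\<close> lies in
  \<open>B\<close>, where \<open>n\<close>-th powers of commutators vanish. The root
  \<open>\<theta>\<close> comes from a push-out: \<open>M\<close> and \<open>X \<otimes> Y\<close>
  are glued along \<open>\<beta>\<close> and multiplication by \<open>n\<close>. In this gluing
  \<open>M\<close> survives exactly when the linear extension of \<open>\<beta>\<close> kills every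
  \<open>t\<close> with \<open>n t = 0\<close>. Such a \<open>t\<close> need not be a pure tensor,
  and \<open>X\<close> and \<open>Y\<close> need not be sums of cyclic groups; but
  \<open>n t = 0\<close> is witnessed by finitely many elements and an integer matrix, and
  diagonalizing that matrix reduces the claim to pure tensors.\<close>

lemma hom_finprod:
  assumes "comm_group G" "comm_group H" "h \<in> hom G H" "f \<in> I \<rightarrow> carrier G"
  shows "h (finprod G f I) = finprod H (\<lambda>i. h (f i)) I"
proof -
  interpret G: comm_group G by fact
  interpret H: comm_group H by fact
  interpret group_hom G H h
    using assms by (simp add: group_hom_def group_hom_axioms_def G.group_axioms H.group_axioms)
  show ?thesis
    using assms(4)
    by (induction I rule: infinite_finite_induct) (auto simp: Pi_iff)
qed

lemma (in comm_group) finprod_int_pow: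
  assumes "f \<in> I \<rightarrow> carrier G"
  shows "finprod G f I [^] (k::int) = finprod G (\<lambda>i. f i [^] k) I"
  by (rule hom_finprod[OF comm_group_axioms comm_group_axioms _ assms])
     (auto simp: hom_def int_pow_distrib)

text \<open>A basis change: \<open>x0\<close> absorbs the multiples \<open>q i\<close> of the other
  elements, and the exponents \<open>r i - q i * c\<close> give them back. It serves the row
  operation in \<open>X\<close> and the column operation in \<open>Y\<close>.\<close>

lemma (in comm_group) finprod_int_pow_shear:
  assumes x: "x \<in> I \<rightarrow> carrier G" and x0: "x0 \<in> carrier G"
  shows "(x0 \<otimes> (\<Otimes>i\<in>I. x i [^] (q i :: int))) [^] (c::int) \<otimes> (\<Otimes>i\<in>I. x i [^] (r i - q i * c))
         = x0 [^] c \<otimes> (\<Otimes>i\<in>I. x i [^] r i)"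
proof -
  have xi: "x i \<in> carrier G" if "i \<in> I" for i using x that by auto
  have "(x0 \<otimes> (\<Otimes>i\<in>I. x i [^] q i)) [^] c \<otimes> (\<Otimes>i\<in>I. x i [^] (r i - q i * c))
      = x0 [^] c \<otimes> ((\<Otimes>i\<in>I. (x i [^] q i) [^] c) \<otimes> (\<Otimes>i\<in>I. x i [^] (r i - q i * c)))"
    using x0 xi by (simp add: int_pow_distrib finprod_int_pow Pi_iff m_assoc)
  also have "(\<Otimes>i\<in>I. (x i [^] q i) [^] c) \<otimes> (\<Otimes>i\<in>I. x i [^] (r i - q i * c))
      = (\<Otimes>i\<in>I. (x i [^] q i) [^] c \<otimes> x i [^] (r i - q i * c))"
    using xi by (intro finprod_multf[symmetric]) auto
  also have "\<dots> = (\<Otimes>i\<in>I. x i [^] r i)"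
    using xi by (intro finprod_cong') (auto simp: int_pow_pow int_pow_mult[symmetric])
  finally show ?thesis .
qed

section \<open>Bilinear maps between abelian groups\<close>

locale bihom = X: comm_group X + Y: comm_group Y + C: comm_group C
  for X :: "('x, 'xx) monoid_scheme" and Y :: "('y, 'yy) monoid_scheme"
    and C :: "('c, 'cc) monoid_scheme" +
  fixes \<beta> :: "'x \<Rightarrow> 'y \<Rightarrow> 'c"
  assumes hom_left: "y \<in> carrier Y \<Longrightarrow> (\<lambda>x. \<beta> x y) \<in> hom X C"
    and hom_right: "x \<in> carrier X \<Longrightarrow> (\<lambda>y. \<beta> x y) \<in> hom Y C"
begin

lemma closed [simp]: "x \<in> carrier X \<Longrightarrow> y \<in> carrier Y \<Longrightarrow> \<beta> x y \<in> carrier C"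
  using hom_left hom_in_carrier by fastforce

lemma mult_left:
  "x \<in> carrier X \<Longrightarrow> x' \<in> carrier X \<Longrightarrow> y \<in> carrier Y \<Longrightarrow>
   \<beta> (x \<otimes>\<^bsub>X\<^esub> x') y = \<beta> x y \<otimes>\<^bsub>C\<^esub> \<beta> x' y"
  using hom_left[of y] by (simp add: hom_def)

lemma mult_right:
  "x \<in> carrier X \<Longrightarrow> y \<in> carrier Y \<Longrightarrow> y' \<in> carrier Y \<Longrightarrow>
   \<beta> x (y \<otimes>\<^bsub>Y\<^esub> y') = \<beta> x y \<otimes>\<^bsub>C\<^esub> \<beta> x y'"
  using hom_right[of x] by (simp add: hom_def)

lemma int_pow_left:
  "x \<in> carrier X \<Longrightarrow> y \<in> carrier Y \<Longrightarrow> \<beta> (x [^]\<^bsub>X\<^esub> (k::int)) y = \<beta> x y [^]\<^bsub>C\<^esub> k"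
  using hom_int_pow[OF hom_left _ X.is_group C.is_group] by simp

lemma int_pow_right:
  "x \<in> carrier X \<Longrightarrow> y \<in> carrier Y \<Longrightarrow> \<beta> x (y [^]\<^bsub>Y\<^esub> (k::int)) = \<beta> x y [^]\<^bsub>C\<^esub> k"
  using hom_int_pow[OF hom_right _ Y.is_group C.is_group] by simp

lemma finprod_left:
  "x \<in> I \<rightarrow> carrier X \<Longrightarrow> y \<in> carrier Y \<Longrightarrow> \<beta> (finprod X x I) y = (\<Otimes>\<^bsub>C\<^esub>i\<in>I. \<beta> (x i) y)"
  by (rule hom_finprod[OF X.comm_group_axioms C.comm_group_axioms hom_left])

lemma finprod_right:
  "x \<in> carrier X \<Longrightarrow> y \<in> I \<rightarrow> carrier Y \<Longrightarrow> \<beta> x (finprod Y y I) = (\<Otimes>\<^bsub>C\<^esub>i\<in>I. \<beta> x (y i))"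
  by (rule hom_finprod[OF Y.comm_group_axioms C.comm_group_axioms hom_right])

end

section \<open>Reduction of relation matrices\<close>

text \<open>The assumptions concern pure tensors with a factor killed by \<open>n\<close>; the goal
  is that \<open>\<beta>\<close> vanishes on all \<open>n\<close>-torsion of the tensor product. For
  \<open>n = 0\<close> they force \<open>\<beta>\<close> to be trivial.\<close>

locale bihom_torsion = bihom X Y C \<beta>
  for X :: "('x, 'xx) monoid_scheme" and Y :: "('y, 'yy) monoid_scheme"
    and C :: "('c, 'cc) monoid_scheme" and \<beta> :: "'x \<Rightarrow> 'y \<Rightarrow> 'c" +
  fixes n :: nat
  assumes torsion_left:
      "x \<in> carrier X \<Longrightarrow> y \<in> carrier Y \<Longrightarrow> x [^]\<^bsub>X\<^esub> n = \<one>\<^bsub>X\<^esub> \<Longrightarrow> \<beta> x y = \<one>\<^bsub>C\<^esub>"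
    and torsion_right:
      "x \<in> carrier X \<Longrightarrow> y \<in> carrier Y \<Longrightarrow> y [^]\<^bsub>Y\<^esub> n = \<one>\<^bsub>Y\<^esub> \<Longrightarrow> \<beta> x y = \<one>\<^bsub>C\<^esub>"
begin

text \<open>
  With \<open>g = gcd n d\<close>, Bezout gives \<open>u = w + (d/g) z\<close> (additively) where \<open>g w = 0\<close>. Then
  \<open>\<beta> x u = \<beta> x w + \<beta> ((d/g) x) z\<close>, and \<open>w\<close> and \<open>(d/g) x\<close> are killed by \<open>g\<close>, hence by \<open>n\<close>.
\<close>

lemma cyclic_relation_trivial:
  assumes x: "x \<in> carrier X" and u: "u \<in> carrier Y" and v: "v \<in> carrier Y"
    and xd: "x [^]\<^bsub>X\<^esub> (d::int) = \<one>\<^bsub>X\<^esub>" and un: "u [^]\<^bsub>Y\<^esub> int n = v [^]\<^bsub>Y\<^esub> d"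
    and d0: "d \<noteq> 0"
  shows "\<beta> x u = \<one>\<^bsub>C\<^esub>"
proof -
  define g where "g = gcd (int n) d"
  define n' where "n' = int n div g"
  define d' where "d' = d div g"
  have g0: "g \<noteq> 0" using d0 by (simp add: g_def)
  have n: "int n = g * n'" and d: "d = g * d'" by (simp_all add: g_def n'_def d'_def)
  have "coprime n' d'"
    unfolding n'_def d'_def g_def using d0 by (intro div_gcd_coprime) simp
  then obtain s t where st: "s * n' + t * d' = 1"
    using bezout_int[of n' d'] by auto
  \<comment> \<open>\<open>w\<close> is killed by \<open>g\<close>, because
    \<open>g n' u = n u = d v = g d' v\<close> in additive notation. The torsion summand announced
    above is \<open>ws\<close>, the multiple of \<open>w\<close> by \<open>s\<close>.\<close>
  define w where "w = u [^]\<^bsub>Y\<^esub> n' \<otimes>\<^bsub>Y\<^esub> v [^]\<^bsub>Y\<^esub> (- d')"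
  have w: "w \<in> carrier Y" using u v by (simp add: w_def)
  have "w [^]\<^bsub>Y\<^esub> g = u [^]\<^bsub>Y\<^esub> int n \<otimes>\<^bsub>Y\<^esub> v [^]\<^bsub>Y\<^esub> (- d)"
    using u v by (simp add: w_def Y.int_pow_distrib Y.int_pow_pow n d mult.commute)
  also have "\<dots> = \<one>\<^bsub>Y\<^esub>" using v by (simp add: un Y.int_pow_mult[symmetric])
  finally have wg: "w [^]\<^bsub>Y\<^esub> g = \<one>\<^bsub>Y\<^esub>" .
  define ws where "ws = w [^]\<^bsub>Y\<^esub> s"
  have ws: "ws \<in> carrier Y" using w by (simp add: ws_def)
  have "ws [^]\<^bsub>Y\<^esub> int n = (w [^]\<^bsub>Y\<^esub> g) [^]\<^bsub>Y\<^esub> (s * n')"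
    using w by (simp add: ws_def Y.int_pow_pow n mult.commute mult.left_commute)
  then have wsn: "ws [^]\<^bsub>Y\<^esub> n = \<one>\<^bsub>Y\<^esub>" by (simp add: wg int_pow_int)
  \<comment> \<open>From \<open>s n' + t d' = 1\<close> one gets
    \<open>u = s n' u + t d' u = s w + d' (s v + t u)\<close>, which dictates
    \<open>z\<close>.\<close>
  define z where "z = v [^]\<^bsub>Y\<^esub> s \<otimes>\<^bsub>Y\<^esub> u [^]\<^bsub>Y\<^esub> t"
  have z: "z \<in> carrier Y" using u v by (simp add: z_def)
  have "ws \<otimes>\<^bsub>Y\<^esub> z [^]\<^bsub>Y\<^esub> d'
      = u [^]\<^bsub>Y\<^esub> (n' * s) \<otimes>\<^bsub>Y\<^esub> (v [^]\<^bsub>Y\<^esub> (- (d' * s)) \<otimes>\<^bsub>Y\<^esub> v [^]\<^bsub>Y\<^esub> (s * d')) \<otimes>\<^bsub>Y\<^esub> u [^]\<^bsub>Y\<^esub> (t * d')"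
    using u v by (simp add: ws_def w_def z_def Y.int_pow_distrib Y.int_pow_pow Y.m_assoc)
  also have "\<dots> = u [^]\<^bsub>Y\<^esub> (n' * s + t * d')"
    using u v by (simp add: Y.int_pow_mult[symmetric] mult.commute)
  also have "\<dots> = u" using st u by (simp add: mult.commute)
  finally have ueq: "u = ws \<otimes>\<^bsub>Y\<^esub> z [^]\<^bsub>Y\<^esub> d'" by simp
  have "(x [^]\<^bsub>X\<^esub> d') [^]\<^bsub>X\<^esub> int n = (x [^]\<^bsub>X\<^esub> d) [^]\<^bsub>X\<^esub> n'"
    using x by (simp add: X.int_pow_pow n d mult.commute mult.left_commute)
  then have xdn: "(x [^]\<^bsub>X\<^esub> d') [^]\<^bsub>X\<^esub> n = \<one>\<^bsub>X\<^esub>" by (simp add: xd int_pow_int)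
  have "\<beta> x u = \<beta> x ws \<otimes>\<^bsub>C\<^esub> \<beta> (x [^]\<^bsub>X\<^esub> d') z"
    unfolding ueq using x ws z by (simp add: mult_right int_pow_right int_pow_left)
  then show ?thesis
    using torsion_right[OF x ws wsn] torsion_left[OF _ z xdn] x by simp
qed

text \<open>
  A relation matrix \<open>r\<close> of this kind witnesses that \<open>\<Sum>i. x i \<otimes> u i\<close> is an \<open>n\<close>-torsion element of the
  tensor product of \<open>X\<close> and \<open>Y\<close>.
\<close>

definition relation_system ::
    "'i set \<Rightarrow> 'j set \<Rightarrow> ('i \<Rightarrow> 'x) \<Rightarrow> ('i \<Rightarrow> 'y) \<Rightarrow> ('j \<Rightarrow> 'y) \<Rightarrow> ('i \<Rightarrow> 'j \<Rightarrow> int) \<Rightarrow> bool" where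
  "relation_system I J x u v r \<longleftrightarrow>
     x \<in> I \<rightarrow> carrier X \<and> u \<in> I \<rightarrow> carrier Y \<and> v \<in> J \<rightarrow> carrier Y \<and>
     (\<forall>j\<in>J. (\<Otimes>\<^bsub>X\<^esub>i\<in>I. x i [^]\<^bsub>X\<^esub> r i j) = \<one>\<^bsub>X\<^esub>) \<and>
     (\<forall>i\<in>I. u i [^]\<^bsub>Y\<^esub> int n = (\<Otimes>\<^bsub>Y\<^esub>j\<in>J. v j [^]\<^bsub>Y\<^esub> r i j))"

lemma relation_systemD:
  assumes "relation_system I J x u v r"
  shows "i \<in> I \<Longrightarrow> x i \<in> carrier X" "i \<in> I \<Longrightarrow> u i \<in> carrier Y" "j \<in> J \<Longrightarrow> v j \<in> carrier Y"
    and "j \<in> J \<Longrightarrow> (\<Otimes>\<^bsub>X\<^esub>i\<in>I. x i [^]\<^bsub>X\<^esub> r i j) = \<one>\<^bsub>X\<^esub>"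
    and "i \<in> I \<Longrightarrow> u i [^]\<^bsub>Y\<^esub> int n = (\<Otimes>\<^bsub>Y\<^esub>j\<in>J. v j [^]\<^bsub>Y\<^esub> r i j)"
  using assms by (auto simp: relation_system_def)

text \<open>The sum of the \<open>x i \<otimes> u i\<close> is preserved: while \<open>x i0\<close>
  absorbs \<open>q i\<close> times \<open>x i\<close>, each \<open>u i\<close> loses
  \<open>q i\<close> times \<open>u i0\<close>, and the powers of
  \<open>\<beta> (x i) (u i0)\<close> with exponents \<open>q i\<close> and \<open>- q i\<close>
  cancel. The rows of the matrix change as \<open>u\<close> does.\<close>

lemma relation_system_row_op:
  fixes q :: "'i \<Rightarrow> int"
  assumes rs: "relation_system (insert i0 I) J x u v r" and I: "finite I" "i0 \<notin> I"
  defines "x' \<equiv> x(i0 := x i0 \<otimes>\<^bsub>X\<^esub> (\<Otimes>\<^bsub>X\<^esub>i\<in>I. x i [^]\<^bsub>X\<^esub> q i))"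
    and "u' \<equiv> \<lambda>i. if i = i0 then u i0 else u i \<otimes>\<^bsub>Y\<^esub> u i0 [^]\<^bsub>Y\<^esub> (- q i)"
    and "r' \<equiv> \<lambda>i j. if i = i0 then r i0 j else r i j - q i * r i0 j"
  shows "relation_system (insert i0 I) J x' u' v r'"
    and "(\<Otimes>\<^bsub>C\<^esub>i\<in>insert i0 I. \<beta> (x' i) (u' i)) = (\<Otimes>\<^bsub>C\<^esub>i\<in>insert i0 I. \<beta> (x i) (u i))"
proof -
  note D = relation_systemD[OF rs]
  have x0: "x i0 \<in> carrier X" and u0: "u i0 \<in> carrier Y" using D by auto
  have xi: "x i \<in> carrier X" and ui: "u i \<in> carrier Y" if "i \<in> I" for i using D that by auto
  have neq: "i \<noteq> i0" if "i \<in> I" for i using that I by auto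
  have x'0: "x' i0 = x i0 \<otimes>\<^bsub>X\<^esub> (\<Otimes>\<^bsub>X\<^esub>i\<in>I. x i [^]\<^bsub>X\<^esub> q i)" by (simp add: x'_def)
  have x'0c: "x' i0 \<in> carrier X" using x0 xi by (simp add: x'_def Pi_iff)
  show "relation_system (insert i0 I) J x' u' v r'"
    unfolding relation_system_def
  proof (intro conjI ballI)
    show "x' \<in> insert i0 I \<rightarrow> carrier X" using x'0c xi by (auto simp: x'_def)
    show "u' \<in> insert i0 I \<rightarrow> carrier Y" using u0 ui by (auto simp: u'_def)
    show "v \<in> J \<rightarrow> carrier Y" using D by auto
  next
    fix j assume j: "j \<in> J"
    have "(\<Otimes>\<^bsub>X\<^esub>i\<in>insert i0 I. x' i [^]\<^bsub>X\<^esub> r' i j)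
        = x' i0 [^]\<^bsub>X\<^esub> r i0 j \<otimes>\<^bsub>X\<^esub> (\<Otimes>\<^bsub>X\<^esub>i\<in>I. x' i [^]\<^bsub>X\<^esub> r' i j)"
      using I x'0c xi neq by (subst X.finprod_insert) (auto simp: x'_def r'_def)
    also have "(\<Otimes>\<^bsub>X\<^esub>i\<in>I. x' i [^]\<^bsub>X\<^esub> r' i j) = (\<Otimes>\<^bsub>X\<^esub>i\<in>I. x i [^]\<^bsub>X\<^esub> (r i j - q i * r i0 j))"
      using xi neq by (intro X.finprod_cong') (auto simp: x'_def r'_def)
    also have "x' i0 [^]\<^bsub>X\<^esub> r i0 j \<otimes>\<^bsub>X\<^esub> \<dots> = x i0 [^]\<^bsub>X\<^esub> r i0 j \<otimes>\<^bsub>X\<^esub> (\<Otimes>\<^bsub>X\<^esub>i\<in>I. x i [^]\<^bsub>X\<^esub> r i j)"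
      unfolding x'0 using x0 xi by (intro X.finprod_int_pow_shear) auto
    also have "\<dots> = (\<Otimes>\<^bsub>X\<^esub>i\<in>insert i0 I. x i [^]\<^bsub>X\<^esub> r i j)"
      using I x0 xi by (subst X.finprod_insert) auto
    finally show "(\<Otimes>\<^bsub>X\<^esub>i\<in>insert i0 I. x' i [^]\<^bsub>X\<^esub> r' i j) = \<one>\<^bsub>X\<^esub>"
      using D(4)[OF j] by simp
  next
    fix i assume i: "i \<in> insert i0 I"
    show "u' i [^]\<^bsub>Y\<^esub> int n = (\<Otimes>\<^bsub>Y\<^esub>j\<in>J. v j [^]\<^bsub>Y\<^esub> r' i j)"
    proof (cases "i = i0")
      case True
      then show ?thesis using D(5)[OF i] by (simp add: u'_def r'_def)
    next
      case False
      with i have iI: "i \<in> I" by simp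
      have "u' i [^]\<^bsub>Y\<^esub> int n = u i [^]\<^bsub>Y\<^esub> int n \<otimes>\<^bsub>Y\<^esub> (u i0 [^]\<^bsub>Y\<^esub> int n) [^]\<^bsub>Y\<^esub> (- q i)"
        using False ui[OF iI] u0 by (simp add: u'_def Y.int_pow_distrib Y.int_pow_pow mult.commute)
      also have "\<dots> = (\<Otimes>\<^bsub>Y\<^esub>j\<in>J. v j [^]\<^bsub>Y\<^esub> r i j) \<otimes>\<^bsub>Y\<^esub> (\<Otimes>\<^bsub>Y\<^esub>j\<in>J. (v j [^]\<^bsub>Y\<^esub> r i0 j) [^]\<^bsub>Y\<^esub> (- q i))"
        using D(3) by (simp add: D(5)[OF i] D(5)[of i0] Y.finprod_int_pow Pi_iff)
      also have "\<dots> = (\<Otimes>\<^bsub>Y\<^esub>j\<in>J. v j [^]\<^bsub>Y\<^esub> r i j \<otimes>\<^bsub>Y\<^esub> (v j [^]\<^bsub>Y\<^esub> r i0 j) [^]\<^bsub>Y\<^esub> (- q i))"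
        using D(3) by (intro Y.finprod_multf[symmetric]) auto
      also have "\<dots> = (\<Otimes>\<^bsub>Y\<^esub>j\<in>J. v j [^]\<^bsub>Y\<^esub> r' i j)"
        using D(3) False
        by (intro Y.finprod_cong')
           (auto simp: r'_def Y.int_pow_pow Y.int_pow_mult[symmetric] mult.commute)
      finally show ?thesis .
    qed
  qed
  have b: "\<beta> (x i) (u i0) \<in> carrier C" "\<beta> (x i) (u i) \<in> carrier C" if "i \<in> I" for i
    using xi ui u0 that by auto
  have "(\<Otimes>\<^bsub>C\<^esub>i\<in>insert i0 I. \<beta> (x' i) (u' i))
      = \<beta> (x' i0) (u i0) \<otimes>\<^bsub>C\<^esub> (\<Otimes>\<^bsub>C\<^esub>i\<in>I. \<beta> (x' i) (u' i))"
    using I x'0c u0 xi ui neq by (subst C.finprod_insert) (auto simp: u'_def x'_def)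
  also have "(\<Otimes>\<^bsub>C\<^esub>i\<in>I. \<beta> (x' i) (u' i))
      = (\<Otimes>\<^bsub>C\<^esub>i\<in>I. \<beta> (x i) (u i) \<otimes>\<^bsub>C\<^esub> \<beta> (x i) (u i0) [^]\<^bsub>C\<^esub> (- q i))"
    using u0 xi ui neq b
    by (intro C.finprod_cong') (auto simp: u'_def x'_def mult_right int_pow_right)
  also have "\<dots> = (\<Otimes>\<^bsub>C\<^esub>i\<in>I. \<beta> (x i) (u i)) \<otimes>\<^bsub>C\<^esub> (\<Otimes>\<^bsub>C\<^esub>i\<in>I. \<beta> (x i) (u i0) [^]\<^bsub>C\<^esub> (- q i))"
    using b by (intro C.finprod_multf) auto
  also have "\<beta> (x' i0) (u i0) = \<beta> (x i0) (u i0) \<otimes>\<^bsub>C\<^esub> (\<Otimes>\<^bsub>C\<^esub>i\<in>I. \<beta> (x i [^]\<^bsub>X\<^esub> q i) (u i0))"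
    using x0 u0 xi by (simp add: x'0 mult_left finprod_left Pi_iff)
  also have "(\<Otimes>\<^bsub>C\<^esub>i\<in>I. \<beta> (x i [^]\<^bsub>X\<^esub> q i) (u i0)) = (\<Otimes>\<^bsub>C\<^esub>i\<in>I. \<beta> (x i) (u i0) [^]\<^bsub>C\<^esub> q i)"
    using u0 xi b by (intro C.finprod_cong') (auto simp: int_pow_left)
  also have "\<beta> (x i0) (u i0) \<otimes>\<^bsub>C\<^esub> (\<Otimes>\<^bsub>C\<^esub>i\<in>I. \<beta> (x i) (u i0) [^]\<^bsub>C\<^esub> q i) \<otimes>\<^bsub>C\<^esub>
        ((\<Otimes>\<^bsub>C\<^esub>i\<in>I. \<beta> (x i) (u i)) \<otimes>\<^bsub>C\<^esub> (\<Otimes>\<^bsub>C\<^esub>i\<in>I. \<beta> (x i) (u i0) [^]\<^bsub>C\<^esub> (- q i)))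
      = \<beta> (x i0) (u i0) \<otimes>\<^bsub>C\<^esub> (\<Otimes>\<^bsub>C\<^esub>i\<in>I. \<beta> (x i) (u i)) \<otimes>\<^bsub>C\<^esub>
        ((\<Otimes>\<^bsub>C\<^esub>i\<in>I. \<beta> (x i) (u i0) [^]\<^bsub>C\<^esub> q i) \<otimes>\<^bsub>C\<^esub> (\<Otimes>\<^bsub>C\<^esub>i\<in>I. \<beta> (x i) (u i0) [^]\<^bsub>C\<^esub> (- q i)))"
    using b x0 u0 by (simp add: Pi_iff C.m_ac)
  also have "(\<Otimes>\<^bsub>C\<^esub>i\<in>I. \<beta> (x i) (u i0) [^]\<^bsub>C\<^esub> q i) \<otimes>\<^bsub>C\<^esub> (\<Otimes>\<^bsub>C\<^esub>i\<in>I. \<beta> (x i) (u i0) [^]\<^bsub>C\<^esub> (- q i))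
      = (\<Otimes>\<^bsub>C\<^esub>i\<in>I. \<beta> (x i) (u i0) [^]\<^bsub>C\<^esub> q i \<otimes>\<^bsub>C\<^esub> \<beta> (x i) (u i0) [^]\<^bsub>C\<^esub> (- q i))"
    using b by (intro C.finprod_multf[symmetric]) auto
  also have "\<dots> = \<one>\<^bsub>C\<^esub>"
    using b by (intro C.finprod_one_eqI) (auto simp: C.int_pow_mult[symmetric])
  also have "\<beta> (x i0) (u i0) \<otimes>\<^bsub>C\<^esub> (\<Otimes>\<^bsub>C\<^esub>i\<in>I. \<beta> (x i) (u i)) \<otimes>\<^bsub>C\<^esub> \<one>\<^bsub>C\<^esub>
      = (\<Otimes>\<^bsub>C\<^esub>i\<in>insert i0 I. \<beta> (x i) (u i))"
    using I b x0 u0 by (subst C.finprod_insert) (auto simp: Pi_iff)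
  finally show "(\<Otimes>\<^bsub>C\<^esub>i\<in>insert i0 I. \<beta> (x' i) (u' i)) = (\<Otimes>\<^bsub>C\<^esub>i\<in>insert i0 I. \<beta> (x i) (u i))" .
qed

text \<open>A change of the \<open>v j\<close> alone, so \<open>x\<close>, \<open>u\<close> and
  hence the product of the \<open>\<beta> (x i) (u i)\<close> stay literally the same. The new
  column relations are combinations of the old ones.\<close>

lemma relation_system_column_op:
  fixes q :: "'j \<Rightarrow> int"
  assumes rs: "relation_system I (insert j0 J) x u v r" and J: "finite J" "j0 \<notin> J"
  defines "v' \<equiv> v(j0 := v j0 \<otimes>\<^bsub>Y\<^esub> (\<Otimes>\<^bsub>Y\<^esub>j\<in>J. v j [^]\<^bsub>Y\<^esub> q j))"
    and "r' \<equiv> \<lambda>i j. if j = j0 then r i j0 else r i j - q j * r i j0"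
  shows "relation_system I (insert j0 J) x u v' r'"
proof -
  note D = relation_systemD[OF rs]
  have v0: "v j0 \<in> carrier Y" using D by auto
  have vj: "v j \<in> carrier Y" if "j \<in> J" for j using D that by auto
  have neq: "j \<noteq> j0" if "j \<in> J" for j using that J by auto
  have v'0: "v' j0 = v j0 \<otimes>\<^bsub>Y\<^esub> (\<Otimes>\<^bsub>Y\<^esub>j\<in>J. v j [^]\<^bsub>Y\<^esub> q j)" by (simp add: v'_def)
  have v'0c: "v' j0 \<in> carrier Y" using v0 vj by (simp add: v'_def Pi_iff)
  show ?thesis
    unfolding relation_system_def
  proof (intro conjI ballI)
    show "x \<in> I \<rightarrow> carrier X" "u \<in> I \<rightarrow> carrier Y" using D by auto
    show "v' \<in> insert j0 J \<rightarrow> carrier Y" using v'0c vj by (auto simp: v'_def)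
  next
    fix j assume j: "j \<in> insert j0 J"
    show "(\<Otimes>\<^bsub>X\<^esub>i\<in>I. x i [^]\<^bsub>X\<^esub> r' i j) = \<one>\<^bsub>X\<^esub>"
    proof (cases "j = j0")
      case True
      then show ?thesis using D(4)[OF j] by (simp add: r'_def)
    next
      case False
      have "(\<Otimes>\<^bsub>X\<^esub>i\<in>I. x i [^]\<^bsub>X\<^esub> r' i j)
          = (\<Otimes>\<^bsub>X\<^esub>i\<in>I. x i [^]\<^bsub>X\<^esub> r i j \<otimes>\<^bsub>X\<^esub> (x i [^]\<^bsub>X\<^esub> r i j0) [^]\<^bsub>X\<^esub> (- q j))"
        using D(1) False
        by (intro X.finprod_cong')
           (auto simp: r'_def X.int_pow_pow X.int_pow_mult[symmetric] mult.commute)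
      also have "\<dots> = (\<Otimes>\<^bsub>X\<^esub>i\<in>I. x i [^]\<^bsub>X\<^esub> r i j) \<otimes>\<^bsub>X\<^esub> (\<Otimes>\<^bsub>X\<^esub>i\<in>I. x i [^]\<^bsub>X\<^esub> r i j0) [^]\<^bsub>X\<^esub> (- q j)"
        using D(1) by (simp add: X.finprod_multf X.finprod_int_pow Pi_iff)
      finally show ?thesis using D(4)[OF j] D(4)[of j0] by simp
    qed
  next
    fix i assume i: "i \<in> I"
    have "(\<Otimes>\<^bsub>Y\<^esub>j\<in>insert j0 J. v' j [^]\<^bsub>Y\<^esub> r' i j)
        = v' j0 [^]\<^bsub>Y\<^esub> r i j0 \<otimes>\<^bsub>Y\<^esub> (\<Otimes>\<^bsub>Y\<^esub>j\<in>J. v' j [^]\<^bsub>Y\<^esub> r' i j)"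
      using J v'0c vj neq by (subst Y.finprod_insert) (auto simp: v'_def r'_def)
    also have "(\<Otimes>\<^bsub>Y\<^esub>j\<in>J. v' j [^]\<^bsub>Y\<^esub> r' i j) = (\<Otimes>\<^bsub>Y\<^esub>j\<in>J. v j [^]\<^bsub>Y\<^esub> (r i j - q j * r i j0))"
      using vj neq by (intro Y.finprod_cong') (auto simp: v'_def r'_def)
    also have "v' j0 [^]\<^bsub>Y\<^esub> r i j0 \<otimes>\<^bsub>Y\<^esub> \<dots> = v j0 [^]\<^bsub>Y\<^esub> r i j0 \<otimes>\<^bsub>Y\<^esub> (\<Otimes>\<^bsub>Y\<^esub>j\<in>J. v j [^]\<^bsub>Y\<^esub> r i j)"
      unfolding v'0 using v0 vj by (intro Y.finprod_int_pow_shear) auto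
    also have "\<dots> = (\<Otimes>\<^bsub>Y\<^esub>j\<in>insert j0 J. v j [^]\<^bsub>Y\<^esub> r i j)"
      using J v0 vj by (subst Y.finprod_insert) auto
    finally show "u i [^]\<^bsub>Y\<^esub> int n = (\<Otimes>\<^bsub>Y\<^esub>j\<in>insert j0 J. v' j [^]\<^bsub>Y\<^esub> r' i j)"
      using D(5)[OF i] by simp
  qed
qed

text \<open>
  Smith normal form by pivoting: row and column operations decrease the pivot until it is the only
  nonzero entry in its row and column, and then its row splits off.
\<close>

lemma relation_system_trivial:
  assumes "finite I" "finite J" "relation_system I J x u v r"
  shows "(\<Otimes>\<^bsub>C\<^esub>i\<in>I. \<beta> (x i) (u i)) = \<one>\<^bsub>C\<^esub>"
  using assms
proof (induction "card I" arbitrary: I x u v r rule: less_induct)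
  case less
  note smaller = less.hyps
  note fI = less.prems(1) and fJ = less.prems(2)
  \<comment> \<open>Two inductions are nested. The outer one, on the number of rows, is kept as
    \<open>smaller\<close> for the moment when a row splits off; the inner one is on the absolute
    value of the pivot and generalizes its position and all data that the operations change.\<close>
  have piv: "(\<Otimes>\<^bsub>C\<^esub>i\<in>I. \<beta> (x i) (u i)) = \<one>\<^bsub>C\<^esub>"
    if "relation_system I J x u v r" "i0 \<in> I" "j0 \<in> J" "r i0 j0 \<noteq> 0" for i0 j0 x u v r
    using that
  proof (induction "nat \<bar>r i0 j0\<bar>" arbitrary: i0 j0 x u v r rule: less_induct)
    case (less i0 j0 r x u v)
    note rs = less.prems(1)
    define I' where "I' = I - {i0}"
    define J' where "J' = J - {j0}"
    have I': "I = insert i0 I'" "finite I'" "i0 \<notin> I'" using less.prems fI by (auto simp: I'_def)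
    have J': "J = insert j0 J'" "finite J'" "j0 \<notin> J'" using less.prems fJ by (auto simp: J'_def)
    define d where "d = r i0 j0"
    have d0: "d \<noteq> 0" using less.prems by (simp add: d_def)
    \<comment> \<open>Division with remainder: subtracting \<open>q i\<close> times the pivot row
      leaves \<open>r i j0 mod d\<close> in the pivot column. A nonzero remainder is smaller than
      \<open>d\<close> in absolute value and becomes the next pivot.\<close>
    define q where "q i = r i j0 div d" for i
    obtain x1 u1 r1 where rs1: "relation_system I J x1 u1 v r1"
      and eq1: "(\<Otimes>\<^bsub>C\<^esub>i\<in>I. \<beta> (x1 i) (u1 i)) = (\<Otimes>\<^bsub>C\<^esub>i\<in>I. \<beta> (x i) (u i))"
      and r1: "r1 i0 j0 = d" "\<And>i. i \<in> I' \<Longrightarrow> r1 i j0 = r i j0 mod d"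
    proof
      show "relation_system I J (x(i0 := x i0 \<otimes>\<^bsub>X\<^esub> (\<Otimes>\<^bsub>X\<^esub>i\<in>I'. x i [^]\<^bsub>X\<^esub> (q i))))
          (\<lambda>i. if i = i0 then u i0 else u i \<otimes>\<^bsub>Y\<^esub> u i0 [^]\<^bsub>Y\<^esub> (- q i)) v
          (\<lambda>i j. if i = i0 then r i0 j else r i j - q i * r i0 j)"
        using relation_system_row_op(1)[of i0 I' J x u v r q] rs I' by simp
      show "(\<Otimes>\<^bsub>C\<^esub>i\<in>I. \<beta> ((x(i0 := x i0 \<otimes>\<^bsub>X\<^esub> (\<Otimes>\<^bsub>X\<^esub>i\<in>I'. x i [^]\<^bsub>X\<^esub> (q i)))) i)
          ((\<lambda>i. if i = i0 then u i0 else u i \<otimes>\<^bsub>Y\<^esub> u i0 [^]\<^bsub>Y\<^esub> (- q i)) i))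
          = (\<Otimes>\<^bsub>C\<^esub>i\<in>I. \<beta> (x i) (u i))"
        using relation_system_row_op(2)[of i0 I' J x u v r q] rs I' by simp
    qed (use I' in \<open>auto simp: d_def q_def minus_div_mult_eq_mod\<close>)
    show ?case
    proof (cases "\<exists>i\<in>I'. r1 i j0 \<noteq> 0")
      case True
      then obtain i where i: "i \<in> I'" "r1 i j0 \<noteq> 0" by blast
      have "nat \<bar>r1 i j0\<bar> < nat \<bar>r i0 j0\<bar>"
        using i r1(2)[OF i(1)] d0 abs_mod_less[of d "r i j0"] by (simp add: d_def[symmetric])
      then show ?thesis
        using less.hyps[OF _ rs1, of i j0] i I' less.prems eq1 by auto
    next
      case False
      \<comment> \<open>The pivot column is now zero outside row \<open>i0\<close>, so subtracting
        its multiples from the other columns changes row \<open>i0\<close> only and keeps the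
        cleared column.\<close>
      define q' where "q' j = r1 i0 j div d" for j
      define v2 where "v2 = v(j0 := v j0 \<otimes>\<^bsub>Y\<^esub> (\<Otimes>\<^bsub>Y\<^esub>j\<in>J'. v j [^]\<^bsub>Y\<^esub> q' j))"
      define r2 where "r2 = (\<lambda>i j. if j = j0 then r1 i j0 else r1 i j - q' j * r1 i j0)"
      have rs2: "relation_system I J x1 u1 v2 r2"
        using relation_system_column_op[of I j0 J' x1 u1 v r1 q'] rs1 J' by (simp add: v2_def r2_def)
      note D = relation_systemD[OF rs2]
      have r2: "r2 i0 j0 = d" "\<And>j. j \<in> J' \<Longrightarrow> r2 i0 j = r1 i0 j mod d"
        "\<And>i. i \<in> I' \<Longrightarrow> r2 i j0 = 0"
        using J' False r1(1) by (auto simp: r2_def q'_def minus_div_mult_eq_mod)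
      show ?thesis
      proof (cases "\<exists>j\<in>J'. r2 i0 j \<noteq> 0")
        case True
        then obtain j where j: "j \<in> J'" "r2 i0 j \<noteq> 0" by blast
        have "nat \<bar>r2 i0 j\<bar> < nat \<bar>r i0 j0\<bar>"
          using j r2(2)[OF j(1)] d0 abs_mod_less[of d "r1 i0 j"] by (simp add: d_def[symmetric])
        then show ?thesis
          using less.hyps[OF _ rs2, of i0 j] j J' less.prems eq1 by auto
      next
        case False
        \<comment> \<open>The pivot is alone in its row and column. At the pivot the system says
          \<open>d x = 0\<close> and \<open>n u = d v\<close>, the situation of
          \<open>cyclic_relation_trivial\<close>.\<close>
        have x0: "x1 i0 \<in> carrier X" and u0: "u1 i0 \<in> carrier Y" and v0: "v2 j0 \<in> carrier Y"
          using D I' J' by auto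
        have xi: "x1 i \<in> carrier X" "u1 i \<in> carrier Y" if "i \<in> I'" for i using D I' that by auto
        have vj: "v2 j \<in> carrier Y" if "j \<in> J'" for j using D J' that by auto
        have split: "(\<Otimes>\<^bsub>X\<^esub>i\<in>I. x1 i [^]\<^bsub>X\<^esub> r2 i j) = x1 i0 [^]\<^bsub>X\<^esub> r2 i0 j \<otimes>\<^bsub>X\<^esub> (\<Otimes>\<^bsub>X\<^esub>i\<in>I'. x1 i [^]\<^bsub>X\<^esub> r2 i j)" for j
          unfolding I'(1) using I' x0 xi by (subst X.finprod_insert) auto
        have "(\<Otimes>\<^bsub>X\<^esub>i\<in>I'. x1 i [^]\<^bsub>X\<^esub> r2 i j0) = \<one>\<^bsub>X\<^esub>"
          by (rule X.finprod_one_eqI) (simp add: r2(3))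
        then have xd: "x1 i0 [^]\<^bsub>X\<^esub> d = \<one>\<^bsub>X\<^esub>"
          using split[of j0] D(4)[of j0] J' x0 by (simp add: r2(1))
        have "(\<Otimes>\<^bsub>Y\<^esub>j\<in>J'. v2 j [^]\<^bsub>Y\<^esub> r2 i0 j) = \<one>\<^bsub>Y\<^esub>"
          by (rule Y.finprod_one_eqI) (use False in auto)
        moreover have "(\<Otimes>\<^bsub>Y\<^esub>j\<in>J. v2 j [^]\<^bsub>Y\<^esub> r2 i0 j) = v2 j0 [^]\<^bsub>Y\<^esub> r2 i0 j0 \<otimes>\<^bsub>Y\<^esub> (\<Otimes>\<^bsub>Y\<^esub>j\<in>J'. v2 j [^]\<^bsub>Y\<^esub> r2 i0 j)"
          unfolding J'(1) using J' v0 vj by (subst Y.finprod_insert) auto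
        ultimately have un: "u1 i0 [^]\<^bsub>Y\<^esub> int n = v2 j0 [^]\<^bsub>Y\<^esub> d"
          using D(5)[of i0] I' v0 by (simp add: r2(1))
        \<comment> \<open>The column relations survive the loss of row \<open>i0\<close>: its
          contribution is \<open>d x = 0\<close> in column \<open>j0\<close> and zero in the other
          columns.\<close>
        have "relation_system I' J x1 u1 v2 r2"
          unfolding relation_system_def
        proof (intro conjI ballI)
          fix j assume j: "j \<in> J"
          have "x1 i0 [^]\<^bsub>X\<^esub> r2 i0 j = \<one>\<^bsub>X\<^esub>"
            using j J' False xd r2(1) by (cases "j = j0") auto
          then show "(\<Otimes>\<^bsub>X\<^esub>i\<in>I'. x1 i [^]\<^bsub>X\<^esub> r2 i j) = \<one>\<^bsub>X\<^esub>"
            using split[of j] D(4)[OF j] xi by (simp add: Pi_iff)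
        qed (use D I' in auto)
        moreover have "card I' < card I" using I' by simp
        ultimately have "(\<Otimes>\<^bsub>C\<^esub>i\<in>I'. \<beta> (x1 i) (u1 i)) = \<one>\<^bsub>C\<^esub>"
          using smaller[of I' x1 u1 v2 r2] I'(2) fJ by blast
        moreover have "\<beta> (x1 i0) (u1 i0) = \<one>\<^bsub>C\<^esub>"
          by (rule cyclic_relation_trivial[OF x0 u0 v0 xd un d0])
        moreover have "(\<Otimes>\<^bsub>C\<^esub>i\<in>I. \<beta> (x1 i) (u1 i)) = \<beta> (x1 i0) (u1 i0) \<otimes>\<^bsub>C\<^esub> (\<Otimes>\<^bsub>C\<^esub>i\<in>I'. \<beta> (x1 i) (u1 i))"
          unfolding I'(1) using I' x0 u0 xi by (subst C.finprod_insert) auto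
        ultimately show ?thesis using eq1 by simp
      qed
    qed
  qed
  note D = relation_systemD[OF less.prems(3)]
  show ?case
  proof (cases "\<exists>i\<in>I. \<exists>j\<in>J. r i j \<noteq> 0")
    case True
    then show ?thesis using piv less.prems(3) by blast
  next
    case False
    show ?thesis
    proof (rule C.finprod_one_eqI)
      fix i assume i: "i \<in> I"
      have "u i [^]\<^bsub>Y\<^esub> int n = \<one>\<^bsub>Y\<^esub>"
        unfolding D(5)[OF i] by (rule Y.finprod_one_eqI) (use False i in auto)
      then show "\<beta> (x i) (u i) = \<one>\<^bsub>C\<^esub>"
        using torsion_right[of "x i" "u i"] D i by (simp add: int_pow_int)
    qed
  qed
qed

end

section \<open>Evaluation homomorphisms on free abelian groups\<close>

lemma (in comm_monoid) finprod_Times: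
  assumes "finite I" "finite J" "\<And>i j. i \<in> I \<Longrightarrow> j \<in> J \<Longrightarrow> f (i, j) \<in> carrier G"
  shows "finprod G f (I \<times> J) = (\<Otimes>i\<in>I. \<Otimes>j\<in>J. f (i, j))"
proof -
  have "finprod G f (\<Union>i\<in>I. Pair i ` J) = (\<Otimes>i\<in>I. finprod G f (Pair i ` J))"
    using assms by (intro finprod_UN_disjoint) (auto simp: pairwise_def disjnt_def)
  also have "\<dots> = (\<Otimes>i\<in>I. \<Otimes>j\<in>J. f (i, j))"
    using assms by (intro finprod_cong' refl) (auto simp: inj_on_def intro!: finprod_closed finprod_reindex)
  also have "(\<Union>i\<in>I. Pair i ` J) = I \<times> J" by auto
  finally show ?thesis .
qed

text \<open>The homomorphism that extends \<open>f\<close> to the free abelian group, written as a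
  product over the support so that coefficients can later be read as matrix entries.\<close>

definition frag_eval :: "('b, 'z) monoid_scheme \<Rightarrow> ('a \<Rightarrow> 'b) \<Rightarrow> ('a \<Rightarrow>\<^sub>0 int) \<Rightarrow> 'b" where
  "frag_eval G f t = (\<Otimes>\<^bsub>G\<^esub>p\<in>Poly_Mapping.keys t. f p [^]\<^bsub>G\<^esub> Poly_Mapping.lookup t p)"

text \<open>Cancellation may shrink the support of a sum, so evaluations are compared over a common
  finite set.\<close>

lemma (in comm_group) frag_eval_superset:
  assumes "finite P" "Poly_Mapping.keys t \<subseteq> P" "f \<in> P \<rightarrow> carrier G"
  shows "frag_eval G f t = (\<Otimes>p\<in>P. f p [^] Poly_Mapping.lookup t p)"
  unfolding frag_eval_def using assms
  by (intro finprod_mono_neutral_cong_left) (auto simp: in_keys_iff)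

lemma (in comm_group) frag_eval_hom:
  assumes f: "f \<in> S \<rightarrow> carrier G"
  shows "frag_eval G f \<in> hom (free_Abelian_group S) G"
proof (rule homI)
  fix t assume "t \<in> carrier (free_Abelian_group S)"
  then show "frag_eval G f t \<in> carrier G"
    using f by (auto simp: frag_eval_def intro!: finprod_closed)
next
  fix s t assume st: "s \<in> carrier (free_Abelian_group S)" "t \<in> carrier (free_Abelian_group S)"
  define P where "P = Poly_Mapping.keys s \<union> Poly_Mapping.keys t"
  have P: "finite P" "Poly_Mapping.keys s \<subseteq> P" "Poly_Mapping.keys t \<subseteq> P"
    "Poly_Mapping.keys (s + t) \<subseteq> P"
    using Poly_Mapping.keys_add[of s t] by (auto simp: P_def)
  have fP: "f \<in> P \<rightarrow> carrier G" using f st by (auto simp: P_def)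
  then have fp: "\<And>p. p \<in> P \<Longrightarrow> f p \<in> carrier G" by auto
  have "frag_eval G f (s + t) = (\<Otimes>p\<in>P. f p [^] Poly_Mapping.lookup s p \<otimes> f p [^] Poly_Mapping.lookup t p)"
    unfolding frag_eval_superset[OF P(1,4) fP] using fp
    by (intro finprod_cong') (auto simp: lookup_add int_pow_mult)
  also have "\<dots> = frag_eval G f s \<otimes> frag_eval G f t"
    unfolding frag_eval_superset[OF P(1,2) fP] frag_eval_superset[OF P(1,3) fP]
    using fp by (intro finprod_multf) auto
  finally show "frag_eval G f (s \<otimes>\<^bsub>free_Abelian_group S\<^esub> t) = frag_eval G f s \<otimes> frag_eval G f t"
    by simp
qed

lemma (in comm_group) frag_eval_frag_of: "f p \<in> carrier G \<Longrightarrow> frag_eval G f (frag_of p) = f p"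
  by (simp add: frag_eval_def)

section \<open>Cosets and the center\<close>

lemma (in normal) rcos_eq_iff:
  assumes "x \<in> carrier G" "y \<in> carrier G"
  shows "H #> x = H #> y \<longleftrightarrow> x \<otimes> inv y \<in> H"
proof
  assume "H #> x = H #> y"
  then show "x \<otimes> inv y \<in> H"
    using rcos_module_imp[OF is_group assms(2)] rcos_self[OF assms(1) is_subgroup] by simp
next
  assume "x \<otimes> inv y \<in> H"
  then have "x \<in> H #> y" using rcos_module_rev[OF is_group assms(2,1)] by simp
  then show "H #> x = H #> y" using repr_independence[OF _ assms(2) is_subgroup] by simp
qed

lemma (in group) group_center_subgroup: "subgroup (group_center G) G"
proof
  fix x y assume "x \<in> group_center G" "y \<in> group_center G"
  then have xy: "x \<in> carrier G" "y \<in> carrier G" "\<And>z. z \<in> carrier G \<Longrightarrow> x \<otimes> z = z \<otimes> x"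
    "\<And>z. z \<in> carrier G \<Longrightarrow> y \<otimes> z = z \<otimes> y"
    by (auto simp: group_center_def)
  have "x \<otimes> y \<otimes> z = z \<otimes> (x \<otimes> y)" if z: "z \<in> carrier G" for z
  proof -
    have "x \<otimes> y \<otimes> z = x \<otimes> (z \<otimes> y)" using xy(1,2) z xy(4)[OF z] by (simp add: m_assoc)
    also have "\<dots> = (z \<otimes> x) \<otimes> y" using xy(1,2) z xy(3)[OF z] m_assoc[of x z y] by simp
    finally show ?thesis using xy(1,2) z by (simp add: m_assoc)
  qed
  then show "x \<otimes> y \<in> group_center G" using xy(1,2) by (simp add: group_center_def)
next
  fix x assume x: "x \<in> group_center G"
  have "inv x \<otimes> y = y \<otimes> inv x" if y: "y \<in> carrier G" for y
  proof -
    have xc: "x \<in> carrier G" using x by (simp add: group_center_def)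
    have "x \<otimes> inv y = inv y \<otimes> x" using x y by (auto simp: group_center_def)
    then have "inv (x \<otimes> inv y) = inv (inv y \<otimes> x)" by (rule arg_cong)
    then show ?thesis using xc y by (simp add: inv_mult_group)
  qed
  then show "inv x \<in> group_center G" using x by (simp add: group_center_def)
qed (auto simp: group_center_def)

lemma (in group) comm_group_group_center: "comm_group (G\<lparr>carrier := group_center G\<rparr>)"
proof -
  interpret Z: group "G\<lparr>carrier := group_center G\<rparr>"
    by (rule subgroup.subgroup_is_group[OF group_center_subgroup group_axioms])
  show ?thesis
  proof (rule Z.group_comm_groupI)
    fix x y assume "x \<in> carrier (G\<lparr>carrier := group_center G\<rparr>)" "y \<in> carrier (G\<lparr>carrier := group_center G\<rparr>)"
    then have "x \<in> group_center G" "y \<in> carrier G" by (auto simp: group_center_def)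
    then have "x \<otimes> y = y \<otimes> x" unfolding group_center_def by blast
    then show "x \<otimes>\<^bsub>G\<lparr>carrier := group_center G\<rparr>\<^esub> y = y \<otimes>\<^bsub>G\<lparr>carrier := group_center G\<rparr>\<^esub> x"
      by simp
  qed
qed

lemma (in group) central_subgroup_normal:
  assumes "subgroup H G" "H \<subseteq> group_center G"
  shows "H \<lhd> G"
  unfolding normal_inv_iff
proof (intro conjI ballI assms)
  fix x h assume "x \<in> carrier G" "h \<in> H"
  moreover from this have "h \<in> carrier G" "x \<otimes> h = h \<otimes> x"
    using assms(2) by (auto simp: group_center_def)
  ultimately show "x \<otimes> h \<otimes> inv x \<in> H" by (simp add: m_assoc)
qed

section \<open>A presentation of the tensor product\<close>

context bihom
begin

text \<open>
  \<open>tensor_free\<close> modulo \<open>tensor_relations\<close> is the tensor product of \<open>X\<close> and \<open>Y\<close>. Describing the relations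
  by columns and rows, rather than by generators, yields the matrix of a \<open>relation_system\<close> directly.
\<close>

definition tensor_column :: "'y \<Rightarrow> ('x \<times> 'y \<Rightarrow>\<^sub>0 int) \<Rightarrow> 'x" where
  "tensor_column y = frag_eval X (\<lambda>p. if snd p = y then fst p else \<one>\<^bsub>X\<^esub>)"

definition tensor_row :: "'x \<Rightarrow> ('x \<times> 'y \<Rightarrow>\<^sub>0 int) \<Rightarrow> 'y" where
  "tensor_row x = frag_eval Y (\<lambda>p. if fst p = x then snd p else \<one>\<^bsub>Y\<^esub>)"

definition tensor_relations :: "('x \<times> 'y \<Rightarrow>\<^sub>0 int) set" where
  "tensor_relations = {r + s | r s.
     Poly_Mapping.keys r \<subseteq> carrier X \<times> carrier Y \<and> (\<forall>y \<in> carrier Y. tensor_column y r = \<one>\<^bsub>X\<^esub>) \<and>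
     Poly_Mapping.keys s \<subseteq> carrier X \<times> carrier Y \<and> (\<forall>x \<in> carrier X. tensor_row x s = \<one>\<^bsub>Y\<^esub>)}"

abbreviation "tensor_free \<equiv> free_Abelian_group (carrier X \<times> carrier Y)"

abbreviation "tensor_eval \<equiv> frag_eval C (\<lambda>p. \<beta> (fst p) (snd p))"

lemma tensor_column_hom: "group_hom tensor_free X (tensor_column y)"
  unfolding tensor_column_def group_hom_def group_hom_axioms_def
  by (auto intro!: X.frag_eval_hom X.is_group)

lemma tensor_row_hom: "group_hom tensor_free Y (tensor_row x)"
  unfolding tensor_row_def group_hom_def group_hom_axioms_def
  by (auto intro!: Y.frag_eval_hom Y.is_group)

lemma tensor_eval_hom: "group_hom tensor_free C tensor_eval"
  unfolding group_hom_def group_hom_axioms_def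
  by (auto intro!: C.frag_eval_hom C.is_group)

lemma tensor_column_frag_of:
  "x \<in> carrier X \<Longrightarrow> tensor_column y (frag_of (x, y')) = (if y' = y then x else \<one>\<^bsub>X\<^esub>)"
  unfolding tensor_column_def by (subst X.frag_eval_frag_of) auto

lemma tensor_row_frag_of:
  "y \<in> carrier Y \<Longrightarrow> tensor_row x (frag_of (x', y)) = (if x' = x then y else \<one>\<^bsub>Y\<^esub>)"
  unfolding tensor_row_def by (subst Y.frag_eval_frag_of) auto

lemma tensor_column_finprod:
  assumes "finite I" "finite J" "I \<subseteq> carrier X" "J \<subseteq> carrier Y" "Poly_Mapping.keys r \<subseteq> I \<times> J" "y \<in> J"
  shows "tensor_column y r = (\<Otimes>\<^bsub>X\<^esub>x\<in>I. x [^]\<^bsub>X\<^esub> Poly_Mapping.lookup r (x, y))"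
proof -
  have I: "x \<in> carrier X" if "x \<in> I" for x using that assms by auto
  have "tensor_column y r = (\<Otimes>\<^bsub>X\<^esub>p\<in>I \<times> J. (if snd p = y then fst p else \<one>\<^bsub>X\<^esub>) [^]\<^bsub>X\<^esub> Poly_Mapping.lookup r p)"
    unfolding tensor_column_def using assms I by (intro X.frag_eval_superset) auto
  also have "\<dots> = (\<Otimes>\<^bsub>X\<^esub>p\<in>(\<lambda>x. (x, y)) ` I. fst p [^]\<^bsub>X\<^esub> Poly_Mapping.lookup r p)"
    using assms I by (intro X.finprod_mono_neutral_cong_right) auto
  also have "\<dots> = (\<Otimes>\<^bsub>X\<^esub>x\<in>I. x [^]\<^bsub>X\<^esub> Poly_Mapping.lookup r (x, y))"
    using I by (subst X.finprod_reindex) (auto simp: inj_on_def)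
  finally show ?thesis .
qed

lemma tensor_row_finprod:
  assumes "finite I" "finite J" "I \<subseteq> carrier X" "J \<subseteq> carrier Y" "Poly_Mapping.keys s \<subseteq> I \<times> J" "x \<in> I"
  shows "tensor_row x s = (\<Otimes>\<^bsub>Y\<^esub>y\<in>J. y [^]\<^bsub>Y\<^esub> Poly_Mapping.lookup s (x, y))"
proof -
  have J: "y \<in> carrier Y" if "y \<in> J" for y using that assms by auto
  have "tensor_row x s = (\<Otimes>\<^bsub>Y\<^esub>p\<in>I \<times> J. (if fst p = x then snd p else \<one>\<^bsub>Y\<^esub>) [^]\<^bsub>Y\<^esub> Poly_Mapping.lookup s p)"
    unfolding tensor_row_def using assms J by (intro Y.frag_eval_superset) auto
  also have "\<dots> = (\<Otimes>\<^bsub>Y\<^esub>p\<in>Pair x ` J. snd p [^]\<^bsub>Y\<^esub> Poly_Mapping.lookup s p)"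
    using assms J by (intro Y.finprod_mono_neutral_cong_right) auto
  also have "\<dots> = (\<Otimes>\<^bsub>Y\<^esub>y\<in>J. y [^]\<^bsub>Y\<^esub> Poly_Mapping.lookup s (x, y))"
    using J by (subst Y.finprod_reindex) (auto simp: inj_on_def)
  finally show ?thesis .
qed

text \<open>Additivity on the right gathers each row of \<open>t\<close> into one element of
  \<open>Y\<close>. This writes \<open>t\<close> as a sum of pure tensors with distinct left
  entries, the shape that \<open>relation_system_trivial\<close> evaluates.\<close>

lemma tensor_eval_finprod:
  assumes "finite I" "finite J" "I \<subseteq> carrier X" "J \<subseteq> carrier Y" "Poly_Mapping.keys t \<subseteq> I \<times> J"
  shows "tensor_eval t = (\<Otimes>\<^bsub>C\<^esub>x\<in>I. \<beta> x (\<Otimes>\<^bsub>Y\<^esub>y\<in>J. y [^]\<^bsub>Y\<^esub> Poly_Mapping.lookup t (x, y)))"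
proof -
  have I: "x \<in> carrier X" if "x \<in> I" for x using that assms by auto
  have J: "y \<in> carrier Y" if "y \<in> J" for y using that assms by auto
  have "tensor_eval t = (\<Otimes>\<^bsub>C\<^esub>p\<in>I \<times> J. \<beta> (fst p) (snd p) [^]\<^bsub>C\<^esub> Poly_Mapping.lookup t p)"
    using assms I J by (intro C.frag_eval_superset) auto
  also have "\<dots> = (\<Otimes>\<^bsub>C\<^esub>x\<in>I. \<Otimes>\<^bsub>C\<^esub>y\<in>J. \<beta> x y [^]\<^bsub>C\<^esub> Poly_Mapping.lookup t (x, y))"
    using assms I J by (subst C.finprod_Times) auto
  also have "\<dots> = (\<Otimes>\<^bsub>C\<^esub>x\<in>I. \<beta> x (\<Otimes>\<^bsub>Y\<^esub>y\<in>J. y [^]\<^bsub>Y\<^esub> Poly_Mapping.lookup t (x, y)))"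
  proof (intro C.finprod_cong' refl)
    fix x assume x: "x \<in> I"
    have "\<beta> x (\<Otimes>\<^bsub>Y\<^esub>y\<in>J. y [^]\<^bsub>Y\<^esub> Poly_Mapping.lookup t (x, y))
        = (\<Otimes>\<^bsub>C\<^esub>y\<in>J. \<beta> x (y [^]\<^bsub>Y\<^esub> Poly_Mapping.lookup t (x, y)))"
      using I[OF x] J by (intro finprod_right) auto
    also have "\<dots> = (\<Otimes>\<^bsub>C\<^esub>y\<in>J. \<beta> x y [^]\<^bsub>C\<^esub> Poly_Mapping.lookup t (x, y))"
      using I[OF x] J by (intro C.finprod_cong') (auto simp: int_pow_right)
    finally show "(\<Otimes>\<^bsub>C\<^esub>y\<in>J. \<beta> x y [^]\<^bsub>C\<^esub> Poly_Mapping.lookup t (x, y))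
        = \<beta> x (\<Otimes>\<^bsub>Y\<^esub>y\<in>J. y [^]\<^bsub>Y\<^esub> Poly_Mapping.lookup t (x, y))" by simp
  qed (use I J in \<open>auto intro!: closed Y.finprod_closed\<close>)
  finally show ?thesis .
qed

text \<open>A sum of two subgroups: the \<open>r\<close> form the common kernel of the column maps,
  the \<open>s\<close> that of the row maps.\<close>

lemma tensor_relations_subgroup: "subgroup tensor_relations tensor_free"
proof -
  have c: "tensor_column y (r + r') = tensor_column y r \<otimes>\<^bsub>X\<^esub> tensor_column y r'"
    "tensor_column y (- r) = inv\<^bsub>X\<^esub> tensor_column y r"
    if "Poly_Mapping.keys r \<subseteq> carrier X \<times> carrier Y" "Poly_Mapping.keys r' \<subseteq> carrier X \<times> carrier Y" for r r' y
    using group_hom.hom_mult[OF tensor_column_hom[of y], of r r']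
      group_hom.hom_inv[OF tensor_column_hom[of y], of r] that by simp_all
  have w: "tensor_row x (r + r') = tensor_row x r \<otimes>\<^bsub>Y\<^esub> tensor_row x r'"
    "tensor_row x (- r) = inv\<^bsub>Y\<^esub> tensor_row x r"
    if "Poly_Mapping.keys r \<subseteq> carrier X \<times> carrier Y" "Poly_Mapping.keys r' \<subseteq> carrier X \<times> carrier Y" for r r' x
    using group_hom.hom_mult[OF tensor_row_hom[of x], of r r']
      group_hom.hom_inv[OF tensor_row_hom[of x], of r] that by simp_all
  have k: "Poly_Mapping.keys (r + r') \<subseteq> carrier X \<times> carrier Y"
    if "Poly_Mapping.keys r \<subseteq> carrier X \<times> carrier Y" "Poly_Mapping.keys r' \<subseteq> carrier X \<times> carrier Y" for r r' :: "'x \<times> 'y \<Rightarrow>\<^sub>0 int"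
    using that Poly_Mapping.keys_add[of r r'] by blast
  show ?thesis
  proof
    show "tensor_relations \<subseteq> carrier tensor_free"
      by (auto simp: tensor_relations_def dest!: subsetD[OF Poly_Mapping.keys_add])
    show "\<one>\<^bsub>tensor_free\<^esub> \<in> tensor_relations"
      unfolding tensor_relations_def
      by clarsimp (rule exI[of _ 0], rule exI[of _ 0],
          simp add: tensor_column_def tensor_row_def frag_eval_def)
  next
    fix a b assume "a \<in> tensor_relations" "b \<in> tensor_relations"
    then obtain r s r' s' where
      a: "a = r + s" "Poly_Mapping.keys r \<subseteq> carrier X \<times> carrier Y" "Poly_Mapping.keys s \<subseteq> carrier X \<times> carrier Y"
         "\<forall>y \<in> carrier Y. tensor_column y r = \<one>\<^bsub>X\<^esub>" "\<forall>x \<in> carrier X. tensor_row x s = \<one>\<^bsub>Y\<^esub>" and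
      b: "b = r' + s'" "Poly_Mapping.keys r' \<subseteq> carrier X \<times> carrier Y" "Poly_Mapping.keys s' \<subseteq> carrier X \<times> carrier Y"
         "\<forall>y \<in> carrier Y. tensor_column y r' = \<one>\<^bsub>X\<^esub>" "\<forall>x \<in> carrier X. tensor_row x s' = \<one>\<^bsub>Y\<^esub>"
      unfolding tensor_relations_def by blast
    have "a \<otimes>\<^bsub>tensor_free\<^esub> b = (r + r') + (s + s')" by (simp add: a b)
    then show "a \<otimes>\<^bsub>tensor_free\<^esub> b \<in> tensor_relations"
      unfolding tensor_relations_def using a b
      by (intro CollectI exI[of _ "r + r'"] exI[of _ "s + s'"]) (simp add: c w k)
  next
    fix a assume "a \<in> tensor_relations"
    then obtain r s where
      a: "a = r + s" "Poly_Mapping.keys r \<subseteq> carrier X \<times> carrier Y" "Poly_Mapping.keys s \<subseteq> carrier X \<times> carrier Y"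
         "\<forall>y \<in> carrier Y. tensor_column y r = \<one>\<^bsub>X\<^esub>" "\<forall>x \<in> carrier X. tensor_row x s = \<one>\<^bsub>Y\<^esub>"
      unfolding tensor_relations_def by blast
    have "inv\<^bsub>tensor_free\<^esub> a = - r + - s" using a k[OF a(2,3)] by simp
    then show "inv\<^bsub>tensor_free\<^esub> a \<in> tensor_relations"
      unfolding tensor_relations_def using a
      by (intro CollectI exI[of _ "- r"] exI[of _ "- s"]) (simp add: c w)
  qed
qed

text \<open>Only column \<open>y\<close> can be nontrivial, and there the three contributions
  cancel; hence \<open>s = 0\<close> will do. The computation goes through the homomorphism because
  the three generators may coincide.\<close>

lemma tensor_relations_left:
  assumes "x \<in> carrier X" "x' \<in> carrier X" "y \<in> carrier Y"
  shows "frag_of (x \<otimes>\<^bsub>X\<^esub> x', y) - (frag_of (x, y) + frag_of (x', y)) \<in> tensor_relations"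
    (is "?r \<in> _")
proof -
  have "tensor_column y' ?r = \<one>\<^bsub>X\<^esub>" for y'
  proof -
    interpret h: group_hom tensor_free X "tensor_column y'" by (rule tensor_column_hom)
    have f: "frag_of (x \<otimes>\<^bsub>X\<^esub> x', y) \<in> carrier tensor_free" "frag_of (x, y) \<in> carrier tensor_free"
       "frag_of (x', y) \<in> carrier tensor_free" using assms by auto
    have "?r = frag_of (x \<otimes>\<^bsub>X\<^esub> x', y) \<otimes>\<^bsub>tensor_free\<^esub> inv\<^bsub>tensor_free\<^esub> (frag_of (x, y) \<otimes>\<^bsub>tensor_free\<^esub> frag_of (x', y))"
      using h.m_closed[OF f(2,3)] by simp
    also have "tensor_column y' \<dots> = tensor_column y' (frag_of (x \<otimes>\<^bsub>X\<^esub> x', y)) \<otimes>\<^bsub>X\<^esub>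
        inv\<^bsub>X\<^esub> (tensor_column y' (frag_of (x, y)) \<otimes>\<^bsub>X\<^esub> tensor_column y' (frag_of (x', y)))"
      using f by (simp only: h.G.inv_closed h.G.m_closed h.hom_inv h.hom_mult)
    also have "\<dots> = \<one>\<^bsub>X\<^esub>"
      using assms by (simp add: tensor_column_frag_of)
    finally show ?thesis .
  qed
  moreover have "Poly_Mapping.keys ?r \<subseteq> carrier X \<times> carrier Y"
    using assms keys_diff[of "frag_of (x \<otimes>\<^bsub>X\<^esub> x', y)" "frag_of (x, y) + frag_of (x', y)"]
      Poly_Mapping.keys_add[of "frag_of (x, y)" "frag_of (x', y)"] by (auto split: if_splits)
  ultimately show ?thesis
    unfolding tensor_relations_def
    by (intro CollectI exI[of _ ?r] exI[of _ 0]) (simp add: tensor_row_def frag_eval_def)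
qed

lemma tensor_relations_right:
  assumes "x \<in> carrier X" "y \<in> carrier Y" "y' \<in> carrier Y"
  shows "frag_of (x, y \<otimes>\<^bsub>Y\<^esub> y') - (frag_of (x, y) + frag_of (x, y')) \<in> tensor_relations"
    (is "?r \<in> _")
proof -
  have "tensor_row x' ?r = \<one>\<^bsub>Y\<^esub>" for x'
  proof -
    interpret h: group_hom tensor_free Y "tensor_row x'" by (rule tensor_row_hom)
    have f: "frag_of (x, y \<otimes>\<^bsub>Y\<^esub> y') \<in> carrier tensor_free" "frag_of (x, y) \<in> carrier tensor_free"
       "frag_of (x, y') \<in> carrier tensor_free" using assms by auto
    have "?r = frag_of (x, y \<otimes>\<^bsub>Y\<^esub> y') \<otimes>\<^bsub>tensor_free\<^esub> inv\<^bsub>tensor_free\<^esub> (frag_of (x, y) \<otimes>\<^bsub>tensor_free\<^esub> frag_of (x, y'))"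
      using h.m_closed[OF f(2,3)] by simp
    also have "tensor_row x' \<dots> = tensor_row x' (frag_of (x, y \<otimes>\<^bsub>Y\<^esub> y')) \<otimes>\<^bsub>Y\<^esub>
        inv\<^bsub>Y\<^esub> (tensor_row x' (frag_of (x, y)) \<otimes>\<^bsub>Y\<^esub> tensor_row x' (frag_of (x, y')))"
      using f by (simp only: h.G.inv_closed h.G.m_closed h.hom_inv h.hom_mult)
    also have "\<dots> = \<one>\<^bsub>Y\<^esub>"
      using assms by (simp add: tensor_row_frag_of)
    finally show ?thesis .
  qed
  moreover have "Poly_Mapping.keys ?r \<subseteq> carrier X \<times> carrier Y"
    using assms keys_diff[of "frag_of (x, y \<otimes>\<^bsub>Y\<^esub> y')" "frag_of (x, y) + frag_of (x, y')"]
      Poly_Mapping.keys_add[of "frag_of (x, y)" "frag_of (x, y')"] by (auto split: if_splits)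
  ultimately show ?thesis
    unfolding tensor_relations_def
    by (intro CollectI exI[of _ 0] exI[of _ ?r]) (simp add: tensor_column_def frag_eval_def)
qed

end

text \<open>Split \<open>n t = r + s\<close> and let \<open>u x\<close> be the row of
  \<open>t\<close> at \<open>x\<close>, summed in \<open>Y\<close>. The columns of \<open>r\<close>
  are relations in \<open>X\<close>, and the rows of \<open>s\<close> vanish in \<open>Y\<close>, so
  \<open>n (u x)\<close> is the row of \<open>r\<close> at \<open>x\<close>. Thus the coefficients
  of \<open>r\<close> are the matrix of a \<open>relation_system\<close> whose \<open>x\<close> and
  \<open>v\<close> are identities.\<close>

lemma (in bihom_torsion) tensor_eval_torsion:
  assumes t: "Poly_Mapping.keys t \<subseteq> carrier X \<times> carrier Y"
    and nt: "frag_cmul (int n) t \<in> tensor_relations"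
  shows "tensor_eval t = \<one>\<^bsub>C\<^esub>"
proof -
  obtain r s where nt: "frag_cmul (int n) t = r + s"
    and r: "Poly_Mapping.keys r \<subseteq> carrier X \<times> carrier Y" "\<And>y. y \<in> carrier Y \<Longrightarrow> tensor_column y r = \<one>\<^bsub>X\<^esub>"
    and s: "Poly_Mapping.keys s \<subseteq> carrier X \<times> carrier Y" "\<And>x. x \<in> carrier X \<Longrightarrow> tensor_row x s = \<one>\<^bsub>Y\<^esub>"
    using nt unfolding tensor_relations_def by blast
  define K where "K = Poly_Mapping.keys t \<union> Poly_Mapping.keys r \<union> Poly_Mapping.keys s"
  define I where "I = fst ` K"
  define J where "J = snd ` K"
  have fin: "finite I" "finite J" by (auto simp: I_def J_def K_def)
  have "K \<subseteq> carrier X \<times> carrier Y" using t r s by (auto simp: K_def)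
  then have sub: "I \<subseteq> carrier X" "J \<subseteq> carrier Y" by (auto simp: I_def J_def)
  have "K \<subseteq> I \<times> J" by (auto simp: I_def J_def rev_image_eqI)
  then have keys: "Poly_Mapping.keys t \<subseteq> I \<times> J" "Poly_Mapping.keys r \<subseteq> I \<times> J" "Poly_Mapping.keys s \<subseteq> I \<times> J"
    by (auto simp: K_def)
  have J: "y \<in> carrier Y" if "y \<in> J" for y using that sub by auto
  let ?u = "\<lambda>x. \<Otimes>\<^bsub>Y\<^esub>y\<in>J. y [^]\<^bsub>Y\<^esub> Poly_Mapping.lookup t (x, y)"
  have "relation_system I J (\<lambda>x. x) ?u (\<lambda>y. y) (\<lambda>x y. Poly_Mapping.lookup r (x, y))"
    unfolding relation_system_def
  proof (intro conjI ballI)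
    show "?u \<in> I \<rightarrow> carrier Y" using J by (auto intro!: Y.finprod_closed)
  next
    fix y assume y: "y \<in> J"
    show "(\<Otimes>\<^bsub>X\<^esub>x\<in>I. x [^]\<^bsub>X\<^esub> Poly_Mapping.lookup r (x, y)) = \<one>\<^bsub>X\<^esub>"
      using tensor_column_finprod[OF fin sub keys(2) y] r(2)[OF J[OF y]] by simp
  next
    fix x assume x: "x \<in> I"
    have l: "int n * Poly_Mapping.lookup t p = Poly_Mapping.lookup r p + Poly_Mapping.lookup s p" for p
      using arg_cong[OF nt, of "\<lambda>z. Poly_Mapping.lookup z p"] by (simp add: lookup_add)
    have "?u x [^]\<^bsub>Y\<^esub> int n = (\<Otimes>\<^bsub>Y\<^esub>y\<in>J. (y [^]\<^bsub>Y\<^esub> Poly_Mapping.lookup t (x, y)) [^]\<^bsub>Y\<^esub> int n)"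
      using J by (intro Y.finprod_int_pow) auto
    also have "\<dots> = (\<Otimes>\<^bsub>Y\<^esub>y\<in>J. y [^]\<^bsub>Y\<^esub> Poly_Mapping.lookup r (x, y) \<otimes>\<^bsub>Y\<^esub> y [^]\<^bsub>Y\<^esub> Poly_Mapping.lookup s (x, y))"
      using J by (intro Y.finprod_cong')
        (auto simp: Y.int_pow_pow Y.int_pow_mult[symmetric] l[symmetric] mult.commute)
    also have "\<dots> = (\<Otimes>\<^bsub>Y\<^esub>y\<in>J. y [^]\<^bsub>Y\<^esub> Poly_Mapping.lookup r (x, y)) \<otimes>\<^bsub>Y\<^esub> tensor_row x s"
      unfolding tensor_row_finprod[OF fin sub keys(3) x] using J by (intro Y.finprod_multf) auto
    finally show "?u x [^]\<^bsub>Y\<^esub> int n = (\<Otimes>\<^bsub>Y\<^esub>y\<in>J. y [^]\<^bsub>Y\<^esub> Poly_Mapping.lookup r (x, y))"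
      using s(2)[of x] x sub J by (simp add: subset_iff Pi_iff)
  qed (use sub in auto)
  from relation_system_trivial[OF fin this] show ?thesis
    unfolding tensor_eval_finprod[OF fin sub keys(1)] .
qed

section \<open>Roots of bilinear maps into the center\<close>

lemma (in group) commutator_closed [simp]:
  "x \<in> carrier G \<Longrightarrow> y \<in> carrier G \<Longrightarrow> commutator G x y \<in> carrier G"
  by (simp add: commutator_def)

lemma (in group) mult_commutator:
  "x \<in> carrier G \<Longrightarrow> y \<in> carrier G \<Longrightarrow> y \<otimes> x \<otimes> commutator G x y = x \<otimes> y"
  by (simp add: commutator_def m_assoc[symmetric])
     (simp add: m_assoc inv_mult_group[symmetric] l_inv_ex)

text \<open>Characterizing the commutator by an equation avoids inverses, which are awkward in
  twisted groups.\<close>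

lemma (in group) commutator_eqI:
  assumes "x \<in> carrier G" "y \<in> carrier G" "w \<in> carrier G" "y \<otimes> x \<otimes> w = x \<otimes> y"
  shows "commutator G x y = w"
  using assms mult_commutator[of x y] by (metis commutator_closed Units_eq Units_l_cancel m_closed)

lemma (in group) commutator_eq_one_iff:
  assumes "x \<in> carrier G" "y \<in> carrier G"
  shows "commutator G x y = \<one> \<longleftrightarrow> x \<otimes> y = y \<otimes> x"
  using assms mult_commutator[of x y] commutator_eqI[of x y \<one>] by auto

lemma (in group) group_centerD:
  "z \<in> group_center G \<Longrightarrow> x \<in> carrier G \<Longrightarrow> z \<otimes> x = x \<otimes> z"
  "z \<in> group_center G \<Longrightarrow> z \<in> carrier G"
  unfolding group_center_def by auto

lemma in_N2_iff_center:
  "in_N2 G \<longleftrightarrow> group G \<and> (\<forall>x \<in> carrier G. \<forall>y \<in> carrier G. commutator G x y \<in> group_center G)"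
proof (cases "group G")
  case True
  interpret group G by fact
  show ?thesis
    unfolding in_N2_def group_center_def
    using True by (auto simp: commutator_eq_one_iff)
qed (simp add: in_N2_def)

lemma hom_commutator:
  assumes "group_hom G H h" "x \<in> carrier G" "y \<in> carrier G"
  shows "h (commutator G x y) = commutator H (h x) (h y)"
proof -
  interpret group_hom G H h by fact
  show ?thesis using assms by (simp add: commutator_def)
qed

lemma comm_group_in_N2:
  assumes "comm_group G" shows "in_N2 G"
proof -
  interpret comm_group G by fact
  show ?thesis
    by (simp add: in_N2_def is_group commutator_eq_one_iff m_comm)
qed

lemma in_N2_DirProd:
  assumes "in_N2 G" "in_N2 H"
  shows "in_N2 (G \<times>\<times> H)"
proof -
  interpret G: group G using assms by (simp add: in_N2_def)
  interpret H: group H using assms by (simp add: in_N2_def)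
  have "commutator (G \<times>\<times> H) (a, b) (c, d) = (commutator G a c, commutator H b d)"
    if "a \<in> carrier G" "c \<in> carrier G" "b \<in> carrier H" "d \<in> carrier H" for a b c d
    using that by (simp add: commutator_def inv_DirProd[OF G.is_group H.is_group])
  then show ?thesis
    using assms by (auto simp: in_N2_def DirProd_group)
qed

lemma in_N2_surj_hom:
  assumes "in_N2 G" "group_hom G H h" "h ` carrier G = carrier H"
  shows "in_N2 H"
proof -
  interpret group_hom G H h by fact
  have "commutator H (commutator H (h x) (h y)) (h z) = \<one>\<^bsub>H\<^esub>"
    if "x \<in> carrier G" "y \<in> carrier G" "z \<in> carrier G" for x y z
    using assms(1) that by (simp add: in_N2_def hom_commutator[OF assms(2), symmetric])
  then show ?thesis
    using H.is_group by (auto simp: in_N2_def assms(3)[symmetric])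
qed

text \<open>
  \<open>W\<close> is the quotient of the product of \<open>M\<close> and \<open>tensor_free\<close> which makes \<open>(x, y)\<close> bilinear and identifies
  its \<open>n\<close>-th multiple with \<open>\<beta> x y\<close>; \<open>tensor_eval_torsion\<close> says that \<open>M\<close> is not collapsed.
\<close>

lemma bihom_torsion_root:
  fixes M :: "('m, 'mm) monoid_scheme"
    and X :: "('x, 'xx) monoid_scheme" and Y :: "('y, 'yy) monoid_scheme"
  assumes M: "in_N2 M"
    and bt: "bihom_torsion X Y (M\<lparr>carrier := group_center M\<rparr>) \<beta> n"
  obtains W :: "('m \<times> ('x \<times> 'y \<Rightarrow>\<^sub>0 int)) set monoid" and \<iota> \<theta>
  where "in_N2 W" "\<iota> \<in> hom M W" "inj_on \<iota> (carrier M)"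
    and "bihom X Y (W\<lparr>carrier := group_center W\<rparr>) \<theta>"
    and "\<And>x y. x \<in> carrier X \<Longrightarrow> y \<in> carrier Y \<Longrightarrow> \<theta> x y [^]\<^bsub>W\<^esub> n = \<iota> (\<beta> x y)"
proof -
  interpret M: group M using M by (simp add: in_N2_def)
  interpret bihom_torsion X Y "M\<lparr>carrier := group_center M\<rparr>" \<beta> n by fact
  define F where "F = tensor_free"
  interpret F: comm_group F unfolding F_def by (rule abelian_free_Abelian_group)
  define P where "P = M \<times>\<times> F"
  interpret P: group P unfolding P_def by (rule DirProd_group[OF M.is_group F.is_group])
  interpret ev: group_hom F "M\<lparr>carrier := group_center M\<rparr>" tensor_eval
    unfolding F_def by (rule tensor_eval_hom)
  interpret R: subgroup tensor_relations F
    unfolding F_def by (rule tensor_relations_subgroup)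
  have evc: "tensor_eval t \<in> group_center M" if "t \<in> carrier F" for t
    using ev.hom_closed[OF that] by simp
  have cM: "z \<in> carrier M" if "z \<in> group_center M" for z using M.group_centerD that by auto
  have invc: "inv\<^bsub>M\<^esub> z \<in> group_center M" if "z \<in> group_center M" for z
    using M.group_center_subgroup that by (simp add: subgroup.m_inv_closed)
  have eva: "tensor_eval (t + t') = tensor_eval t \<otimes>\<^bsub>M\<^esub> tensor_eval t'" if "t \<in> carrier F" "t' \<in> carrier F" for t t'
    using ev.hom_mult[OF that] by (simp add: F_def)
  have evn: "tensor_eval (- t) = inv\<^bsub>M\<^esub> tensor_eval t" if "t \<in> carrier F" for t
    using ev.hom_inv[OF that] that evc[OF that] M.m_inv_consistent[OF M.group_center_subgroup]
    by (simp add: F_def)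
  have ev0: "tensor_eval 0 = \<one>\<^bsub>M\<^esub>" using ev.hom_one by (simp add: F_def)
  have Fadd: "t + t' \<in> carrier F" if "t \<in> carrier F" "t' \<in> carrier F" for t t'
    using F.m_closed[OF that] by (simp add: F_def)
  have Fneg: "- t \<in> carrier F" if "t \<in> carrier F" for t
    using that by (simp add: F_def)
  have Fmul: "frag_cmul k t \<in> carrier F" if "t \<in> carrier F" for k t
    using that keys_cmul[of k t] by (auto simp: F_def)
  have F0: "0 \<in> carrier F" by (simp add: F_def)
  have R0: "0 \<in> tensor_relations" using R.one_closed by (simp add: F_def)
  have Radd: "a + b \<in> tensor_relations" if "a \<in> tensor_relations" "b \<in> tensor_relations" for a b
    using R.m_closed[OF that] by (simp add: F_def)
  have RF: "a \<in> carrier F" if "a \<in> tensor_relations" for a using R.mem_carrier[OF that] .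
  have Rneg: "- a \<in> tensor_relations" if "a \<in> tensor_relations" for a
    using R.m_inv_closed[OF that] RF[OF that] by (simp add: F_def)
  \<comment> \<open>The antidiagonal of the push-out together with the tensor relations: modulo
    \<open>S\<close>, the multiple \<open>n t\<close> equals \<open>tensor_eval t\<close>. Since
    \<open>tensor_eval\<close> has central values and \<open>F\<close> is abelian, \<open>S\<close>
    is central and therefore normal.\<close>
  define S where "S = {(inv\<^bsub>M\<^esub> tensor_eval t, frag_cmul (int n) t + a) | t a.
      t \<in> carrier F \<and> a \<in> tensor_relations}"
  have SI: "(inv\<^bsub>M\<^esub> tensor_eval t, frag_cmul (int n) t + a) \<in> S"
    if "t \<in> carrier F" "a \<in> tensor_relations" for t a
    using that by (auto simp: S_def)
  have S_center: "S \<subseteq> group_center P"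
  proof
    fix p assume "p \<in> S"
    then obtain z s where p: "p = (z, s)" "z \<in> group_center M" "s \<in> carrier F"
      using evc invc Fadd Fmul RF by (auto simp: S_def)
    show "p \<in> group_center P"
      unfolding group_center_def
      using p M.group_centerD F.m_comm by (auto simp: P_def)
  qed
  have S_sub: "subgroup S P"
  proof
    show "S \<subseteq> carrier P" using S_center P.group_centerD by auto
    show "\<one>\<^bsub>P\<^esub> \<in> S" using SI[OF F0 R0] by (simp add: P_def ev0) (simp add: F_def)
  next
    fix p q assume "p \<in> S" "q \<in> S"
    then obtain t a t' a' where p: "p = (inv\<^bsub>M\<^esub> tensor_eval t, frag_cmul (int n) t + a)"
        "t \<in> carrier F" "a \<in> tensor_relations"
      and q: "q = (inv\<^bsub>M\<^esub> tensor_eval t', frag_cmul (int n) t' + a')"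
        "t' \<in> carrier F" "a' \<in> tensor_relations" by (auto simp: S_def)
    have "inv\<^bsub>M\<^esub> tensor_eval (t' + t) = inv\<^bsub>M\<^esub> tensor_eval t \<otimes>\<^bsub>M\<^esub> inv\<^bsub>M\<^esub> tensor_eval t'"
      using p q evc cM by (simp add: eva M.inv_mult_group)
    then have "p \<otimes>\<^bsub>P\<^esub> q = (inv\<^bsub>M\<^esub> tensor_eval (t' + t), frag_cmul (int n) (t' + t) + (a + a'))"
      by (simp add: P_def p q) (simp add: F_def frag_cmul_distrib2 add_ac)
    then show "p \<otimes>\<^bsub>P\<^esub> q \<in> S" using SI Fadd Radd p q by simp
  next
    fix p assume "p \<in> S"
    then obtain t a where p: "p = (inv\<^bsub>M\<^esub> tensor_eval t, frag_cmul (int n) t + a)"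
        "t \<in> carrier F" "a \<in> tensor_relations" by (auto simp: S_def)
    have "frag_cmul (int n) t + a \<in> carrier F" using p Fadd Fmul RF by simp
    then have "inv\<^bsub>P\<^esub> p = (inv\<^bsub>M\<^esub> (inv\<^bsub>M\<^esub> tensor_eval t), - (frag_cmul (int n) t + a))"
      using p evc cM by (simp add: P_def inv_DirProd[OF M.is_group F.is_group]) (simp add: F_def)
    also have "\<dots> = (inv\<^bsub>M\<^esub> tensor_eval (- t), frag_cmul (int n) (- t) + (- a))"
      using p by (simp add: evn poly_mapping_eqI)
    finally show "inv\<^bsub>P\<^esub> p \<in> S" using SI[OF Fneg[OF p(2)] Rneg[OF p(3)]] by simp
  qed
  interpret S: normal S P by (rule P.central_subgroup_normal[OF S_sub S_center])
  \<comment> \<open>\<open>n t + a = 0\<close> makes \<open>n t\<close> a tensor relation, so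
    \<open>t\<close> represents an \<open>n\<close>-torsion element. This is where the torsion
    assumptions on \<open>\<beta>\<close> enter.\<close>
  have S_inj: "z = \<one>\<^bsub>M\<^esub>" if zS: "(z, 0) \<in> S" for z
  proof -
    obtain t a where t: "z = inv\<^bsub>M\<^esub> tensor_eval t" "frag_cmul (int n) t + a = 0"
        "t \<in> carrier F" "a \<in> tensor_relations" using zS by (auto simp: S_def)
    have "frag_cmul (int n) t \<in> tensor_relations"
      using Rneg[OF t(4)] t(2) by (simp add: eq_neg_iff_add_eq_0[symmetric])
    then show ?thesis
      using t tensor_eval_torsion[of t] by (simp add: F_def)
  qed
  define W where "W = P Mod S"
  define \<pi> where "\<pi> = (\<lambda>a. S #>\<^bsub>P\<^esub> a)"
  interpret W: group W unfolding W_def by (rule S.factorgroup_is_group)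
  have pi_hom: "\<pi> \<in> hom P W" unfolding W_def \<pi>_def by (rule S.r_coset_hom_Mod)
  interpret pi: group_hom P W \<pi>
    using pi_hom by (simp add: group_hom_def group_hom_axioms_def P.is_group W.is_group)
  have pi_surj: "\<pi> ` carrier P = carrier W" unfolding \<pi>_def W_def carrier_FactGroup ..
  have pi_eq: "\<pi> (m, t) = \<pi> (m', t') \<longleftrightarrow> (m \<otimes>\<^bsub>M\<^esub> inv\<^bsub>M\<^esub> m', t - t') \<in> S"
    if "m \<in> carrier M" "m' \<in> carrier M" "t \<in> carrier F" "t' \<in> carrier F" for m m' t t'
  proof -
    have "(m, t) \<otimes>\<^bsub>P\<^esub> inv\<^bsub>P\<^esub> (m', t') = (m \<otimes>\<^bsub>M\<^esub> inv\<^bsub>M\<^esub> m', t - t')"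
      using that by (simp add: P_def inv_DirProd[OF M.is_group F.is_group]) (simp add: F_def)
    then show ?thesis
      using S.rcos_eq_iff[of "(m, t)" "(m', t')"] that by (simp add: \<pi>_def P_def)
  qed
  have "comm_group F" by (rule F.comm_group_axioms)
  then have "in_N2 P" unfolding P_def by (intro in_N2_DirProd M comm_group_in_N2)
  then have W2: "in_N2 W" by (rule in_N2_surj_hom[OF _ pi.group_hom_axioms pi_surj])
  define \<iota> where "\<iota> m = \<pi> (m, 0)" for m
  define \<theta> where "\<theta> x y = \<pi> (\<one>\<^bsub>M\<^esub>, frag_of (x, y))" for x y
  have iota_hom: "\<iota> \<in> hom M W"
  proof (rule homI)
    fix a b assume ab: "a \<in> carrier M" "b \<in> carrier M"
    have "(a \<otimes>\<^bsub>M\<^esub> b, 0) = (a, 0) \<otimes>\<^bsub>P\<^esub> (b, 0)" by (simp add: P_def) (simp add: F_def)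
    moreover have "(a, 0) \<in> carrier P" "(b, 0) \<in> carrier P" using ab F0 by (auto simp: P_def)
    ultimately show "\<iota> (a \<otimes>\<^bsub>M\<^esub> b) = \<iota> a \<otimes>\<^bsub>W\<^esub> \<iota> b"
      by (simp only: \<iota>_def pi.hom_mult)
  qed (use F0 in \<open>auto simp: \<iota>_def P_def intro!: pi.hom_closed\<close>)
  have iota_inj: "inj_on \<iota> (carrier M)"
  proof (rule inj_onI)
    fix a b assume ab: "a \<in> carrier M" "b \<in> carrier M" "\<iota> a = \<iota> b"
    then have "a \<otimes>\<^bsub>M\<^esub> inv\<^bsub>M\<^esub> b = \<one>\<^bsub>M\<^esub>"
      using S_inj pi_eq[of a b 0 0] F0 by (simp add: \<iota>_def)
    then show "a = b" using ab M.inv_equality[of a "inv\<^bsub>M\<^esub> b"] by simp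
  qed
  have pc: "\<pi> (\<one>\<^bsub>M\<^esub>, t) \<in> group_center W" if t: "t \<in> carrier F" for t
  proof -
    have "\<pi> (\<one>\<^bsub>M\<^esub>, t) \<otimes>\<^bsub>W\<^esub> \<pi> p = \<pi> p \<otimes>\<^bsub>W\<^esub> \<pi> (\<one>\<^bsub>M\<^esub>, t)" if p: "p \<in> carrier P" for p
    proof -
      have "(\<one>\<^bsub>M\<^esub>, t) \<otimes>\<^bsub>P\<^esub> p = p \<otimes>\<^bsub>P\<^esub> (\<one>\<^bsub>M\<^esub>, t)"
        using p t F.m_comm by (auto simp: P_def)
      moreover have "(\<one>\<^bsub>M\<^esub>, t) \<in> carrier P" using t by (simp add: P_def)
      ultimately show ?thesis using p by (metis pi.hom_mult)
    qed
    moreover have "\<pi> (\<one>\<^bsub>M\<^esub>, t) \<in> carrier W" using t by (simp add: P_def)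
    ultimately show ?thesis unfolding group_center_def by (auto simp: pi_surj[symmetric])
  qed
  have fr: "frag_of (x, y) \<in> carrier F" if "x \<in> carrier X" "y \<in> carrier Y" for x y
    using that by (simp add: F_def)
  have rel: "\<pi> (\<one>\<^bsub>M\<^esub>, t) = \<pi> (\<one>\<^bsub>M\<^esub>, s) \<otimes>\<^bsub>W\<^esub> \<pi> (\<one>\<^bsub>M\<^esub>, s')"
    if "t - (s + s') \<in> tensor_relations" "t \<in> carrier F" "s \<in> carrier F" "s' \<in> carrier F" for t s s'
  proof -
    have "\<pi> (\<one>\<^bsub>M\<^esub>, t) = \<pi> (\<one>\<^bsub>M\<^esub>, s + s')"
      using pi_eq[of "\<one>\<^bsub>M\<^esub>" "\<one>\<^bsub>M\<^esub>" t "s + s'"] Fadd that SI[OF F0 that(1)] by (simp add: ev0)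
    also have "(\<one>\<^bsub>M\<^esub>, s + s') = (\<one>\<^bsub>M\<^esub>, s) \<otimes>\<^bsub>P\<^esub> (\<one>\<^bsub>M\<^esub>, s')" by (simp add: P_def) (simp add: F_def)
    also have "\<pi> \<dots> = \<pi> (\<one>\<^bsub>M\<^esub>, s) \<otimes>\<^bsub>W\<^esub> \<pi> (\<one>\<^bsub>M\<^esub>, s')"
      using that by (intro pi.hom_mult) (auto simp: P_def)
    finally show ?thesis .
  qed
  have "bihom X Y (W\<lparr>carrier := group_center W\<rparr>) \<theta>"
  proof (intro bihom.intro bihom_axioms.intro X.comm_group_axioms Y.comm_group_axioms
      W.comm_group_group_center)
    fix y assume y: "y \<in> carrier Y"
    show "(\<lambda>x. \<theta> x y) \<in> hom X (W\<lparr>carrier := group_center W\<rparr>)"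
      unfolding \<theta>_def using y
      by (intro homI) (simp add: pc fr, simp, intro rel tensor_relations_left fr X.m_closed)
  next
    fix x assume x: "x \<in> carrier X"
    show "\<theta> x \<in> hom Y (W\<lparr>carrier := group_center W\<rparr>)"
      unfolding \<theta>_def using x
      by (intro homI) (simp add: pc fr, simp, intro rel tensor_relations_right fr Y.m_closed)
  qed
  moreover have "\<theta> x y [^]\<^bsub>W\<^esub> n = \<iota> (\<beta> x y)" if xy: "x \<in> carrier X" "y \<in> carrier Y" for x y
  proof -
    have b: "\<beta> x y \<in> group_center M" using closed[OF xy] by simp
    have "(\<one>\<^bsub>M\<^esub>, frag_of (x, y)) [^]\<^bsub>P\<^esub> k = (\<one>\<^bsub>M\<^esub>, frag_cmul (int k) (frag_of (x, y)))" for k :: nat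
      by (induction k) (simp_all add: P_def, simp_all add: F_def frag_cmul_distrib)
    then have "\<theta> x y [^]\<^bsub>W\<^esub> n = \<pi> (\<one>\<^bsub>M\<^esub>, frag_cmul (int n) (frag_of (x, y)))"
      using fr[OF xy] pi.hom_nat_pow[of "(\<one>\<^bsub>M\<^esub>, frag_of (x, y))" n] by (simp add: \<theta>_def P_def)
    also have "\<dots> = \<pi> (\<beta> x y, 0)"
    proof (subst pi_eq)
      have "tensor_eval (frag_of (x, y)) = \<beta> x y"
        using C.frag_eval_frag_of[of "\<lambda>p. \<beta> (fst p) (snd p)" "(x, y)"] closed[OF xy] by simp
      then show "(\<one>\<^bsub>M\<^esub> \<otimes>\<^bsub>M\<^esub> inv\<^bsub>M\<^esub> \<beta> x y, frag_cmul (int n) (frag_of (x, y)) - 0) \<in> S"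
        using SI[OF fr[OF xy] R0] cM[OF b] by simp
    qed (use cM[OF b] fr[OF xy] Fmul F0 in auto)
    finally show ?thesis by (simp add: \<iota>_def)
  qed
  ultimately show thesis using that W2 iota_hom iota_inj by blast
qed

section \<open>Groups of class two\<close>

locale class2_group = group G for G (structure) +
  assumes commutator_central:
    "x \<in> carrier G \<Longrightarrow> y \<in> carrier G \<Longrightarrow> commutator G x y \<in> group_center G"

lemma in_N2_iff_class2_group: "in_N2 G \<longleftrightarrow> class2_group G"
  by (auto simp: in_N2_iff_center class2_group_def class2_group_axioms_def)

lemma (in group) commutator_swap:
  "x \<in> carrier G \<Longrightarrow> y \<in> carrier G \<Longrightarrow> commutator G y x = inv (commutator G x y)"
  by (simp add: commutator_def inv_mult_group m_assoc)

context class2_group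
begin

lemma commutator_comm:
  "x \<in> carrier G \<Longrightarrow> y \<in> carrier G \<Longrightarrow> z \<in> carrier G \<Longrightarrow>
   commutator G x y \<otimes> z = z \<otimes> commutator G x y"
  using group_centerD(1)[OF commutator_central] by simp

text \<open>Moving \<open>z\<close> past \<open>y\<close> and then past \<open>x\<close> produces
  \<open>[y, z]\<close> and \<open>[x, z]\<close>; centrality lets the latter pass
  \<open>y\<close>.\<close>

lemma commutator_mult_left:
  assumes [simp]: "x \<in> carrier G" "y \<in> carrier G" "z \<in> carrier G"
  shows "commutator G (x \<otimes> y) z = commutator G x z \<otimes> commutator G y z"
proof (rule commutator_eqI)
  have "x \<otimes> y \<otimes> z = x \<otimes> (z \<otimes> y \<otimes> commutator G y z)"
    using mult_commutator[of y z] by (simp add: m_assoc)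
  also have "\<dots> = (x \<otimes> z) \<otimes> y \<otimes> commutator G y z" by (simp add: m_assoc)
  also have "x \<otimes> z = z \<otimes> x \<otimes> commutator G x z" by (simp add: mult_commutator)
  also have "z \<otimes> x \<otimes> commutator G x z \<otimes> y \<otimes> commutator G y z
      = z \<otimes> x \<otimes> (commutator G x z \<otimes> y) \<otimes> commutator G y z" by (simp add: m_assoc)
  also have "commutator G x z \<otimes> y = y \<otimes> commutator G x z" by (simp add: commutator_comm)
  finally show "z \<otimes> (x \<otimes> y) \<otimes> (commutator G x z \<otimes> commutator G y z) = x \<otimes> y \<otimes> z"
    by (simp add: m_assoc)
qed auto

lemma commutator_mult_right:
  assumes [simp]: "x \<in> carrier G" "y \<in> carrier G" "z \<in> carrier G"
  shows "commutator G x (y \<otimes> z) = commutator G x y \<otimes> commutator G x z"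
proof -
  have "commutator G x (y \<otimes> z) = inv (commutator G y x \<otimes> commutator G z x)"
    by (simp add: commutator_swap[of "y \<otimes> z" x] commutator_mult_left)
  also have "\<dots> = commutator G x z \<otimes> commutator G x y"
    by (simp add: inv_mult_group commutator_swap[symmetric])
  also have "\<dots> = commutator G x y \<otimes> commutator G x z" by (rule commutator_comm) auto
  finally show ?thesis .
qed

lemma commutator_hom_left: "z \<in> carrier G \<Longrightarrow> group_hom G G (\<lambda>x. commutator G x z)"
  by (simp add: group_hom_def group_hom_axioms_def is_group hom_def commutator_mult_left)

lemma commutator_hom_right: "x \<in> carrier G \<Longrightarrow> group_hom G G (commutator G x)"
  by (simp add: group_hom_def group_hom_axioms_def is_group hom_def commutator_mult_right)

lemma commutator_pow_left:
  "x \<in> carrier G \<Longrightarrow> y \<in> carrier G \<Longrightarrow> commutator G (x [^] (k::nat)) y = commutator G x y [^] k"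
  using group_hom.hom_nat_pow[OF commutator_hom_left[of y]] by simp

text \<open>The class-two case of the Hall-Petrescu formula. In the induction step, moving the new
  \<open>x\<close> past \<open>y\<^sup>k\<close> costs \<open>[y, x]\<^sup>k\<close>, and the
  binomial coefficient grows by \<open>k\<close>.\<close>

lemma mult_pow:
  assumes [simp]: "x \<in> carrier G" "y \<in> carrier G"
  shows "(x \<otimes> y) [^] (k::nat) = x [^] k \<otimes> y [^] k \<otimes> commutator G y x [^] (k choose 2)"
proof (induction k)
  case (Suc k)
  define c where "c = commutator G y x"
  have [simp]: "c \<in> carrier G" by (simp add: c_def)
  have cc: "c [^] (j::nat) \<otimes> z = z \<otimes> c [^] j" if [simp]: "z \<in> carrier G" for z j
    using commutator_comm[of "y [^] j" x z] by (simp add: c_def commutator_pow_left)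
  have sw: "y [^] k \<otimes> x = x \<otimes> y [^] k \<otimes> c [^] k"
    using mult_commutator[of "y [^] k" x] by (simp add: commutator_pow_left c_def)
  have "(x \<otimes> y) [^] Suc k = x [^] k \<otimes> y [^] k \<otimes> (c [^] (k choose 2) \<otimes> (x \<otimes> y))"
    by (simp add: Suc c_def m_assoc)
  also have "\<dots> = x [^] k \<otimes> (y [^] k \<otimes> x) \<otimes> y \<otimes> c [^] (k choose 2)"
    unfolding cc[of "x \<otimes> y" "k choose 2", simplified] by (simp add: m_assoc)
  also have "\<dots> = x [^] k \<otimes> x \<otimes> y [^] k \<otimes> (c [^] k \<otimes> y) \<otimes> c [^] (k choose 2)"
    unfolding sw by (simp add: m_assoc)
  also have "\<dots> = x [^] Suc k \<otimes> y [^] Suc k \<otimes> (c [^] k \<otimes> c [^] (k choose 2))"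
    unfolding cc[of y k, simplified] by (simp add: m_assoc)
  also have "c [^] k \<otimes> c [^] (k choose 2) = c [^] (Suc k choose 2)"
    by (simp add: nat_pow_mult numeral_2_eq_2)
  finally show ?case by (simp add: c_def)
qed (simp add: numeral_2_eq_2)

lemma derived_subset_center: "derived G (carrier G) \<subseteq> group_center G"
  unfolding derived_def
proof (rule generate_subgroup_incl[OF _ group_center_subgroup])
  \<comment> \<open>\<open>derived\<close> is generated by commutators in the opposite convention,
    which are the present commutators of the inverses.\<close>
  have "x \<otimes> y \<otimes> inv x \<otimes> inv y = commutator G (inv x) (inv y)"
    if "x \<in> carrier G" "y \<in> carrier G" for x y
    using that by (simp add: commutator_def)
  then show "derived_set G (carrier G) \<subseteq> group_center G"
    using commutator_central by auto
qed

end

text \<open>By \<open>mult_pow\<close>, \<open>m choose 2\<close> is the exponent of the commutator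
  in an \<open>m\<close>-th power of a product. It is a multiple of \<open>m / 2\<close> for even
  \<open>m\<close> and of \<open>m\<close> for odd \<open>m\<close>, which explains the gcd in the
  hypothesis.\<close>

lemma dvd_choose_two:
  fixes m n :: nat
  assumes "n dvd m div gcd 2 m"
  shows "n dvd m choose 2"
proof (cases "even m")
  case True
  then obtain j where j: "m = 2 * j" by blast
  have "n dvd j" using assms by (simp add: j)
  moreover have "m choose 2 = j * (m - 1)" by (simp add: choose_two j)
  ultimately show ?thesis by simp
next
  case False
  then obtain j where j: "m = 2 * j + 1" using oddE by blast
  have "gcd 2 m = 1" using False by (simp add: coprime_iff_gcd_eq_1[symmetric])
  then have "n dvd m" using assms by simp
  moreover have "m choose 2 = m * j" by (simp add: choose_two j)
  ultimately show ?thesis by simp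
qed

text \<open>Reduces the identities to generators. The commutator is a homomorphism with central
  values in each argument, so \<open>n\<close>-th powers stay trivial when first one argument and
  then the other runs through the generated group. For exponent \<open>m\<close>, the error term of
  \<open>mult_pow\<close> is a power of \<open>[b, a]\<^sup>n\<close>.\<close>

lemma (in class2_group) in_variety_generate:
  assumes S: "S \<subseteq> carrier G" and mn: "n dvd m div gcd 2 m"
    and Sm: "\<And>s. s \<in> S \<Longrightarrow> s [^] m = \<one>"
    and Sn: "\<And>s t. s \<in> S \<Longrightarrow> t \<in> S \<Longrightarrow> commutator G s t [^] n = \<one>"
  shows "in_variety m n (G\<lparr>carrier := generate G S\<rparr>)"
proof -
  let ?H = "generate G S"
  have H: "subgroup ?H G" by (rule generate_is_subgroup[OF S])
  have HG: "x \<in> carrier G" if "x \<in> ?H" for x using that H by (rule subgroup.mem_carrier[rotated])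
  have SG: "s \<in> carrier G" if "s \<in> S" for s using S that by auto
  have step: "h x [^] n = \<one>"
    if h: "group_hom G G h" and hc: "\<And>x. x \<in> carrier G \<Longrightarrow> h x \<in> group_center G"
      and hS: "\<And>s. s \<in> S \<Longrightarrow> h s [^] n = \<one>" and x: "x \<in> ?H" for h x
  proof -
    interpret h: group_hom G G h by fact
    show ?thesis
      using x
    proof (induction rule: generate.induct)
      case (inv s)
      then show ?case using SG[OF inv] hS[OF inv] by (simp add: nat_pow_inv)
    next
      case (eng a b)
      have ab: "a \<in> carrier G" "b \<in> carrier G" using eng HG by auto
      have "(h a \<otimes> h b) [^] n = h a [^] n \<otimes> h b [^] n"
        using ab by (intro pow_mult_distrib group_centerD(1)[OF hc] h.hom_closed)
      then show ?case using ab eng by simp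
    qed (use hS in auto)
  qed
  have Hn1: "commutator G x s [^] n = \<one>" if "x \<in> ?H" "s \<in> S" for x s
    by (rule step[OF commutator_hom_left]) (use that in \<open>auto simp: Sn SG commutator_central\<close>)
  have Hn: "commutator G x y [^] n = \<one>" if "x \<in> ?H" "y \<in> ?H" for x y
    by (rule step[OF commutator_hom_right]) (use that in \<open>auto simp: Hn1 HG commutator_central\<close>)
  have Hm: "x [^] m = \<one>" if "x \<in> ?H" for x
    using that
  proof (induction rule: generate.induct)
    case (inv s)
    then show ?case using SG[OF inv] Sm[OF inv] by (simp add: nat_pow_inv)
  next
    case (eng a b)
    have ab: "a \<in> carrier G" "b \<in> carrier G" using eng HG by auto
    obtain l where l: "m choose 2 = n * l" using dvd_choose_two[OF mn] by blast
    have "commutator G b a [^] (m choose 2) = (commutator G b a [^] n) [^] l"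
      using ab by (simp add: l nat_pow_pow)
    also have "\<dots> = \<one>" using Hn[of b a] eng by simp
    finally show ?case using ab eng by (simp add: mult_pow)
  qed (use Sm in auto)
  have comm: "commutator (G\<lparr>carrier := ?H\<rparr>) x y = commutator G x y" if "x \<in> ?H" "y \<in> ?H" for x y
    using that H by (simp add: commutator_def)
  have ccl: "commutator G x y \<in> ?H" if "x \<in> ?H" "y \<in> ?H" for x y
    using that H unfolding commutator_def by (intro subgroup.m_closed subgroup.m_inv_closed) auto
  have "commutator G (commutator G x y) z = \<one>" if "x \<in> ?H" "y \<in> ?H" "z \<in> ?H" for x y z
    using that HG commutator_comm[of x y z] by (simp add: commutator_eq_one_iff)
  then show ?thesis
    unfolding in_variety_def
    using subgroup.subgroup_is_group[OF H is_group] Hm Hn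
    by (simp add: comm ccl nat_pow_consistent[symmetric])
qed

section \<open>Twisting a group by a bilinear cocycle\<close>

text \<open>The multiplication is deformed to \<open>x y \<omega>(x, y)\<close>. Bilinearity
  provides the cocycle identity; since \<open>\<omega>\<close> is trivial on its own values, the
  deformed multiplication on the same carrier is associative.\<close>

locale twisting = class2_group G for G (structure) +
  fixes \<omega> :: "'a \<Rightarrow> 'a \<Rightarrow> 'a"
  assumes central: "x \<in> carrier G \<Longrightarrow> y \<in> carrier G \<Longrightarrow> \<omega> x y \<in> group_center G"
    and twist_mult_left: "x \<in> carrier G \<Longrightarrow> y \<in> carrier G \<Longrightarrow> z \<in> carrier G \<Longrightarrow>
        \<omega> (x \<otimes> y) z = \<omega> x z \<otimes> \<omega> y z"
    and twist_mult_right: "x \<in> carrier G \<Longrightarrow> y \<in> carrier G \<Longrightarrow> z \<in> carrier G \<Longrightarrow>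
        \<omega> x (y \<otimes> z) = \<omega> x y \<otimes> \<omega> x z"
    and twist_twist_left: "x \<in> carrier G \<Longrightarrow> y \<in> carrier G \<Longrightarrow> z \<in> carrier G \<Longrightarrow> \<omega> (\<omega> x y) z = \<one>"
    and twist_twist_right: "x \<in> carrier G \<Longrightarrow> y \<in> carrier G \<Longrightarrow> z \<in> carrier G \<Longrightarrow> \<omega> z (\<omega> x y) = \<one>"
begin

lemma twist_closed [simp]: "x \<in> carrier G \<Longrightarrow> y \<in> carrier G \<Longrightarrow> \<omega> x y \<in> carrier G"
  using group_centerD(2)[OF central] .

lemma twist_comm:
  "x \<in> carrier G \<Longrightarrow> y \<in> carrier G \<Longrightarrow> z \<in> carrier G \<Longrightarrow> \<omega> x y \<otimes> z = z \<otimes> \<omega> x y"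
  using group_centerD(1)[OF central] .

lemma twist_hom_left: "z \<in> carrier G \<Longrightarrow> group_hom G G (\<lambda>x. \<omega> x z)"
  by (simp add: group_hom_def group_hom_axioms_def is_group hom_def twist_mult_left)

lemma twist_hom_right: "x \<in> carrier G \<Longrightarrow> group_hom G G (\<omega> x)"
  by (simp add: group_hom_def group_hom_axioms_def is_group hom_def twist_mult_right)

text \<open>A homomorphism with central values has an abelian image and hence kills
  commutators.\<close>

lemma twist_commutator_left:
  "x \<in> carrier G \<Longrightarrow> y \<in> carrier G \<Longrightarrow> z \<in> carrier G \<Longrightarrow> \<omega> (commutator G x y) z = \<one>"
  using hom_commutator[OF twist_hom_left[of z], of x y] twist_comm[of x z "\<omega> y z"]
  by (simp add: commutator_eq_one_iff)

lemma twist_commutator_right: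
  "x \<in> carrier G \<Longrightarrow> y \<in> carrier G \<Longrightarrow> z \<in> carrier G \<Longrightarrow> \<omega> z (commutator G x y) = \<one>"
  using hom_commutator[OF twist_hom_right[of z], of x y] twist_comm[of z x "\<omega> z y"]
  by (simp add: commutator_eq_one_iff)

definition twisted :: "('a, 'b) monoid_scheme" where
  "twisted = G\<lparr>mult := \<lambda>x y. x \<otimes> y \<otimes> \<omega> x y\<rparr>"

lemma twisted_simps [simp]:
  "carrier twisted = carrier G" "\<one>\<^bsub>twisted\<^esub> = \<one>" "x \<otimes>\<^bsub>twisted\<^esub> y = x \<otimes> y \<otimes> \<omega> x y"
  by (simp_all add: twisted_def)

lemma twist_one_left [simp]: "x \<in> carrier G \<Longrightarrow> \<omega> \<one> x = \<one>"
  using group_hom.hom_one[OF twist_hom_left] .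

lemma twist_one_right [simp]: "x \<in> carrier G \<Longrightarrow> \<omega> x \<one> = \<one>"
  using group_hom.hom_one[OF twist_hom_right] .

lemma twisted_group: "group twisted"
proof (rule groupI)
  fix x y z assume "x \<in> carrier twisted" "y \<in> carrier twisted" "z \<in> carrier twisted"
  then have [simp]: "x \<in> carrier G" "y \<in> carrier G" "z \<in> carrier G" by auto
  have "x \<otimes>\<^bsub>twisted\<^esub> y \<otimes>\<^bsub>twisted\<^esub> z = x \<otimes> y \<otimes> (\<omega> x y \<otimes> z) \<otimes> (\<omega> x z \<otimes> \<omega> y z)"
    by (simp add: twist_mult_left twist_twist_left m_assoc)
  also have "\<dots> = x \<otimes> y \<otimes> z \<otimes> (\<omega> x y \<otimes> (\<omega> x z \<otimes> \<omega> y z))"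
    unfolding twist_comm[of x y z, simplified] by (simp add: m_assoc)
  also have "\<omega> x y \<otimes> (\<omega> x z \<otimes> \<omega> y z) = \<omega> y z \<otimes> (\<omega> x y \<otimes> \<omega> x z)"
    using twist_comm[of y z "\<omega> x y \<otimes> \<omega> x z"] by (simp add: m_assoc)
  also have "x \<otimes> y \<otimes> z \<otimes> \<dots> = x \<otimes>\<^bsub>twisted\<^esub> (y \<otimes>\<^bsub>twisted\<^esub> z)"
    by (simp add: twist_mult_right twist_twist_right m_assoc)
  finally show "x \<otimes>\<^bsub>twisted\<^esub> y \<otimes>\<^bsub>twisted\<^esub> z = x \<otimes>\<^bsub>twisted\<^esub> (y \<otimes>\<^bsub>twisted\<^esub> z)" .
next
  fix x assume "x \<in> carrier twisted"
  then have [simp]: "x \<in> carrier G" by simp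
  \<comment> \<open>The factor \<open>\<omega> x x\<close> in the left inverse compensates
    \<open>\<omega> (inv x) x\<close>, which is its inverse by bilinearity.\<close>
  have "(inv x \<otimes> \<omega> x x) \<otimes>\<^bsub>twisted\<^esub> x = inv x \<otimes> (\<omega> x x \<otimes> x) \<otimes> \<omega> (inv x) x"
    by (simp add: twist_mult_left twist_twist_left m_assoc)
  also have "\<dots> = (inv x \<otimes> x) \<otimes> (\<omega> x x \<otimes> \<omega> (inv x) x)"
    unfolding twist_comm[of x x x, simplified] by (simp add: m_assoc[symmetric])
  also have "\<dots> = \<one>"
    using twist_mult_left[of x "inv x" x] by simp
  finally show "\<exists>y\<in>carrier twisted. y \<otimes>\<^bsub>twisted\<^esub> x = \<one>\<^bsub>twisted\<^esub>"
    by (intro bexI[of _ "inv x \<otimes> \<omega> x x"]) auto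
qed auto

text \<open>Twisting multiplies commutators by the antisymmetrization of \<open>\<omega>\<close>.
  When \<open>\<omega>(b, a)\<close> is trivial, all of \<open>\<omega>(a, b)\<close> goes into
  \<open>[a, b]\<close>.\<close>

lemma twisted_commutator:
  assumes [simp]: "x \<in> carrier G" "y \<in> carrier G"
  shows "commutator twisted x y = commutator G x y \<otimes> (\<omega> x y \<otimes> inv (\<omega> y x))"
proof -
  interpret T: group twisted by (rule twisted_group)
  let ?k = "commutator G x y \<otimes> (\<omega> x y \<otimes> inv (\<omega> y x))"
  \<comment> \<open>\<open>?k\<close> lies in the right kernel of \<open>\<omega>\<close>, so
    multiplying by it in \<open>twisted\<close> is the same as in \<open>G\<close>.\<close>
  have ker: "\<omega> z ?k = \<one>" if [simp]: "z \<in> carrier G" for z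
  proof -
    interpret h: group_hom G G "\<omega> z" by (rule twist_hom_right) simp
    show ?thesis by (simp add: twist_commutator_right twist_twist_right)
  qed
  show ?thesis
  proof (rule T.commutator_eqI)
    have "y \<otimes>\<^bsub>twisted\<^esub> x \<otimes>\<^bsub>twisted\<^esub> ?k = y \<otimes> x \<otimes> (\<omega> y x \<otimes> commutator G x y) \<otimes> (\<omega> x y \<otimes> inv (\<omega> y x))"
      by (simp add: ker m_assoc)
    also have "\<dots> = (y \<otimes> x \<otimes> commutator G x y) \<otimes> (\<omega> y x \<otimes> (\<omega> x y \<otimes> inv (\<omega> y x)))"
      unfolding twist_comm[of y x "commutator G x y", simplified] by (simp add: m_assoc)
    also have "\<omega> y x \<otimes> (\<omega> x y \<otimes> inv (\<omega> y x)) = \<omega> x y"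
      using twist_comm[of y x "\<omega> x y \<otimes> inv (\<omega> y x)"] by (simp add: m_assoc)
    finally show "y \<otimes>\<^bsub>twisted\<^esub> x \<otimes>\<^bsub>twisted\<^esub> ?k = x \<otimes>\<^bsub>twisted\<^esub> y"
      by (simp add: mult_commutator)
  qed auto
qed

lemma twisted_commutator_kernel:
  assumes [simp]: "x \<in> carrier G" "y \<in> carrier G" "z \<in> carrier G"
  shows "\<omega> (commutator twisted x y) z = \<one>" "\<omega> z (commutator twisted x y) = \<one>"
proof -
  interpret l: group_hom G G "\<lambda>x. \<omega> x z" by (rule twist_hom_left) simp
  interpret r: group_hom G G "\<omega> z" by (rule twist_hom_right) simp
  show "\<omega> (commutator twisted x y) z = \<one>"
    using l.hom_mult[of "commutator G x y" "\<omega> x y \<otimes> inv (\<omega> y x)"]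
      l.hom_mult[of "\<omega> x y" "inv (\<omega> y x)"] l.hom_inv[of "\<omega> y x"]
    by (simp add: twisted_commutator twist_commutator_left twist_twist_left)
  show "\<omega> z (commutator twisted x y) = \<one>"
    by (simp add: twisted_commutator twist_commutator_right twist_twist_right)
qed

lemma twisted_commutator_central:
  assumes "x \<in> carrier G" "y \<in> carrier G"
  shows "commutator twisted x y \<in> group_center G"
  unfolding twisted_commutator[OF assms] using assms
  by (intro subgroup.m_closed[OF group_center_subgroup] subgroup.m_inv_closed[OF group_center_subgroup]
      commutator_central central)

text \<open>The new commutators are central in \<open>G\<close> and lie in both kernels of
  \<open>\<omega>\<close>. Products with them are therefore untwisted, and centrality carries
  over.\<close>

lemma twisted_class2_group: "class2_group twisted"
proof -
  have "commutator twisted x y \<in> group_center twisted"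
    if xy: "x \<in> carrier G" "y \<in> carrier G" for x y
  proof -
    note c = twisted_commutator_central[OF xy]
    have "commutator twisted x y \<otimes>\<^bsub>twisted\<^esub> z = z \<otimes>\<^bsub>twisted\<^esub> commutator twisted x y"
      if z: "z \<in> carrier G" for z
      using group_centerD(1)[OF c z] by (simp add: twisted_commutator_kernel xy z)
    then show ?thesis using group_centerD(2)[OF c] by (simp add: group_center_def)
  qed
  then show ?thesis
    by (simp add: class2_group_def class2_group_axioms_def twisted_group)
qed

lemma twisted_commutator_pow:
  assumes "x \<in> carrier G" "y \<in> carrier G"
  shows "commutator twisted x y [^]\<^bsub>twisted\<^esub> (k::nat) = commutator twisted x y [^] k"
proof (induction k)
  case (Suc k)
  interpret T: group twisted by (rule twisted_group)
  have [simp]: "commutator twisted x y \<in> carrier G" using T.commutator_closed assms by simp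
  show ?case using assms Suc by (simp add: twisted_commutator_kernel)
qed simp

text \<open>Images on which \<open>\<omega>\<close> is trivial do not notice the twist; this is how
  \<open>A\<close> and \<open>B\<close> keep their multiplication.\<close>

lemma twisted_hom:
  assumes "h \<in> hom H G" "\<And>x y. x \<in> carrier H \<Longrightarrow> y \<in> carrier H \<Longrightarrow> \<omega> (h x) (h y) = \<one>"
  shows "h \<in> hom H twisted"
  using assms by (auto simp: hom_def Pi_iff)

end

section \<open>Amalgams\<close>

lemma (in group) supergroup_derived_normal:
  assumes "subgroup N G" "derived G (carrier G) \<subseteq> N"
  shows "N \<lhd> G" "comm_group (G Mod N)"
proof -
  interpret N: subgroup N G by fact
  have com: "x \<otimes> y \<otimes> inv x \<otimes> inv y \<in> N" if "x \<in> carrier G" "y \<in> carrier G" for x y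
    using assms(2) that generate.incl[of _ "derived_set G (carrier G)" G] unfolding derived_def by blast
  show norm: "N \<lhd> G"
    unfolding normal_inv_iff
  proof (intro conjI ballI assms(1))
    fix x h assume xh: "x \<in> carrier G" "h \<in> N"
    then have "(x \<otimes> h \<otimes> inv x \<otimes> inv h) \<otimes> h \<in> N" using com by simp
    then show "x \<otimes> h \<otimes> inv x \<in> N" using xh by (simp add: m_assoc)
  qed
  interpret N: normal N G by fact
  show "comm_group (G Mod N)"
  proof (rule group.group_comm_groupI[OF N.factorgroup_is_group])
    fix P Q assume "P \<in> carrier (G Mod N)" "Q \<in> carrier (G Mod N)"
    then obtain x y where xy: "P = N #> x" "Q = N #> y" "x \<in> carrier G" "y \<in> carrier G"
      by (auto simp: carrier_FactGroup)
    have "N #> (x \<otimes> y) = N #> (y \<otimes> x)"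
      using N.rcos_eq_iff[of "x \<otimes> y" "y \<otimes> x"] com[of x y] xy(3,4) by (simp add: inv_mult_group m_assoc)
    then show "P \<otimes>\<^bsub>G Mod N\<^esub> Q = Q \<otimes>\<^bsub>G Mod N\<^esub> P"
      using xy by (simp add: N.rcos_sum)
  qed
qed

text \<open>Bilinearity and the two kernel conditions make \<open>\<kappa>\<close> depend only on
  the cosets of its arguments, so \<open>\<beta>\<close> may evaluate it at arbitrarily chosen
  representatives.\<close>

lemma bihom_FactGroup:
  assumes N: "N \<lhd> A" "comm_group (A Mod N)" and N': "N' \<lhd> B" "comm_group (B Mod N')"
    and C: "comm_group C"
    and left: "\<And>b. b \<in> carrier B \<Longrightarrow> (\<lambda>a. \<kappa> a b) \<in> hom A C"
    and right: "\<And>a. a \<in> carrier A \<Longrightarrow> \<kappa> a \<in> hom B C"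
    and kerl: "\<And>a b. a \<in> N \<Longrightarrow> b \<in> carrier B \<Longrightarrow> \<kappa> a b = \<one>\<^bsub>C\<^esub>"
    and kerr: "\<And>a b. a \<in> carrier A \<Longrightarrow> b \<in> N' \<Longrightarrow> \<kappa> a b = \<one>\<^bsub>C\<^esub>"
  obtains \<beta> where "bihom (A Mod N) (B Mod N') C \<beta>"
    and "\<And>a b. a \<in> carrier A \<Longrightarrow> b \<in> carrier B \<Longrightarrow> \<beta> (N #>\<^bsub>A\<^esub> a) (N' #>\<^bsub>B\<^esub> b) = \<kappa> a b"
proof -
  interpret N: normal N A by fact
  interpret N': normal N' B by fact
  interpret C: comm_group C by fact
  have kc: "\<kappa> a b \<in> carrier C" if "a \<in> carrier A" "b \<in> carrier B" for a b
    using left that by (auto simp: hom_def Pi_iff)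
  define \<beta> where "\<beta> P Q = \<kappa> (SOME a. a \<in> P) (SOME b. b \<in> Q)" for P Q
  have val: "\<beta> (N #>\<^bsub>A\<^esub> a) (N' #>\<^bsub>B\<^esub> b) = \<kappa> a b" if ab: "a \<in> carrier A" "b \<in> carrier B" for a b
  proof -
    have "(SOME x. x \<in> N #>\<^bsub>A\<^esub> a) \<in> N #>\<^bsub>A\<^esub> a"
      by (rule someI) (rule N.rcos_self[OF ab(1) N.is_subgroup])
    then obtain h where h: "h \<in> N" "(SOME x. x \<in> N #>\<^bsub>A\<^esub> a) = h \<otimes>\<^bsub>A\<^esub> a"
      by (auto simp: r_coset_def)
    have "(SOME x. x \<in> N' #>\<^bsub>B\<^esub> b) \<in> N' #>\<^bsub>B\<^esub> b"
      by (rule someI) (rule N'.rcos_self[OF ab(2) N'.is_subgroup])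
    then obtain h' where h': "h' \<in> N'" "(SOME x. x \<in> N' #>\<^bsub>B\<^esub> b) = h' \<otimes>\<^bsub>B\<^esub> b"
      by (auto simp: r_coset_def)
    have hc: "h \<in> carrier A" "h' \<in> carrier B" using h h' by auto
    have "\<beta> (N #>\<^bsub>A\<^esub> a) (N' #>\<^bsub>B\<^esub> b) = \<kappa> (h \<otimes>\<^bsub>A\<^esub> a) (h' \<otimes>\<^bsub>B\<^esub> b)"
      by (simp add: \<beta>_def h h')
    also have "\<dots> = \<kappa> h (h' \<otimes>\<^bsub>B\<^esub> b) \<otimes>\<^bsub>C\<^esub> \<kappa> a (h' \<otimes>\<^bsub>B\<^esub> b)"
      using hom_mult[OF left[of "h' \<otimes>\<^bsub>B\<^esub> b"], of h a] hc ab by simp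
    also have "\<kappa> a (h' \<otimes>\<^bsub>B\<^esub> b) = \<kappa> a h' \<otimes>\<^bsub>C\<^esub> \<kappa> a b"
      using hom_mult[OF right[of a], of h' b] hc ab by simp
    finally show ?thesis using kerl h kerr h' hc ab kc by simp
  qed
  have "bihom (A Mod N) (B Mod N') C \<beta>"
  proof (intro bihom.intro bihom_axioms.intro N(2) N'(2) C)
    fix Q assume "Q \<in> carrier (B Mod N')"
    then obtain b where b: "b \<in> carrier B" "Q = N' #>\<^bsub>B\<^esub> b" by (auto simp: carrier_FactGroup)
    show "(\<lambda>P. \<beta> P Q) \<in> hom (A Mod N) C"
      by (rule homI) (use left[OF b(1)] in
        \<open>auto simp: carrier_FactGroup b val kc N.rcos_sum hom_def Pi_iff\<close>)
  next
    fix P assume "P \<in> carrier (A Mod N)"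
    then obtain a where a: "a \<in> carrier A" "P = N #>\<^bsub>A\<^esub> a" by (auto simp: carrier_FactGroup)
    show "\<beta> P \<in> hom (B Mod N') C"
      by (rule homI) (use right[OF a(1)] in
        \<open>auto simp: carrier_FactGroup a val kc N'.rcos_sum hom_def Pi_iff\<close>)
  qed
  then show thesis using that val by blast
qed

section \<open>Central elements and commutators in an amalgam\<close>

lemma (in class2_group) hom_derived_central:
  assumes "group_hom H G h" "u \<in> derived H (carrier H)"
  shows "h u \<in> group_center G"
proof -
  interpret h: group_hom H G h by fact
  have "h ` derived H (carrier H) = derived G (h ` carrier H)"
    using h.derived_img[of "carrier H"] by simp
  also have "\<dots> \<subseteq> derived G (carrier G)" by (rule mono_derived) auto
  finally show ?thesis using derived_subset_center assms(2) by blast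
qed

text \<open>The center is a subgroup, so \<open>n\<close>-th powers and elements of the derived
  subgroup can be treated separately. The case \<open>n = 0\<close> is split off because
  \<open>power_subgroup\<close> is then trivial by definition.\<close>

lemma (in class2_group) hom_power_derived_central:
  assumes h: "group_hom H G h"
    and n: "\<And>x y. x \<in> carrier G \<Longrightarrow> y \<in> carrier G \<Longrightarrow> commutator G x y [^] n = \<one>"
    and a: "a \<in> power_subgroup H n <#>\<^bsub>H\<^esub> derived H (carrier H)"
  shows "h a \<in> group_center G"
proof -
  interpret h: group_hom H G h by fact
  note Z = group_center_subgroup
  have pow: "h (x [^]\<^bsub>H\<^esub> n) \<in> group_center G" if x: "x \<in> carrier H" for x
  proof -
    have "h x [^] n \<otimes> y = y \<otimes> h x [^] n" if "y \<in> carrier G" for y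
      using commutator_eq_one_iff[of "h x [^] n" y] x that n[of "h x" y] by (simp add: commutator_pow_left)
    then show ?thesis using x by (simp add: h.hom_nat_pow group_center_def)
  qed
  have "p \<in> carrier H \<and> h p \<in> group_center G" if "p \<in> power_subgroup H n" for p
  proof (cases "n = 0")
    case True
    then show ?thesis using that subgroup.one_closed[OF Z] by (simp add: power_subgroup_def)
  next
    case False
    then have "p \<in> generate H ((\<lambda>x. x [^]\<^bsub>H\<^esub> n) ` carrier H)" using that by (simp add: power_subgroup_def)
    then show ?thesis
    proof (induction rule: generate.induct)
      case (inv x)
      then show ?case using pow subgroup.m_inv_closed[OF Z] by auto
    qed (use pow subgroup.m_closed[OF Z] subgroup.one_closed[OF Z] in auto)
  qed
  moreover obtain p u where pu: "a = p \<otimes>\<^bsub>H\<^esub> u" "p \<in> power_subgroup H n" "u \<in> derived H (carrier H)"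
    using a by (auto simp: set_mult_def)
  moreover have "u \<in> carrier H" using pu(3) h.G.derived_in_carrier[of "carrier H"] by auto
  ultimately show ?thesis
    using hom_derived_central[OF h pu(3)] subgroup.m_closed[OF Z] by simp
qed

text \<open>The common image of \<open>i d\<close> and \<open>j d\<close> is central in all of
  \<open>M\<close>, in particular it commutes with the image of \<open>B\<close>; injectivity of
  \<open>g\<close> pulls this back to \<open>B\<close>.\<close>

lemma strongly_embeddable_imp_central:
  assumes am: "amalgam A B D i j" and M: "in_variety m n M" and emb: "strong_embedding A B D i j M f g"
    and d: "d \<in> carrier D" "i d \<in> power_subgroup A n <#>\<^bsub>A\<^esub> derived A (carrier A)"
  shows "j d \<in> group_center B"
proof -
  interpret M: class2_group M
    using M in_N2_iff_class2_group[of M] by (simp add: in_variety_def in_N2_def)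
  interpret B: group B using am by (simp add: amalgam_def)
  have f: "group_hom A M f" and g: "group_hom B M g"
    using emb am M.is_group by (auto simp: strong_embedding_def amalgam_def group_hom_def group_hom_axioms_def)
  interpret g: group_hom B M g by fact
  have jd: "j d \<in> carrier B" using am d by (auto simp: amalgam_def hom_def)
  have "f (i d) \<in> group_center M"
    by (rule M.hom_power_derived_central[OF f _ d(2)]) (use M in \<open>auto simp: in_variety_def\<close>)
  moreover have "f (i d) = g (j d)" using emb d by (simp add: strong_embedding_def)
  ultimately have c: "g (j d) \<in> group_center M" by simp
  have "j d \<otimes>\<^bsub>B\<^esub> b = b \<otimes>\<^bsub>B\<^esub> j d" if b: "b \<in> carrier B" for b
  proof -
    have "g (j d \<otimes>\<^bsub>B\<^esub> b) = g (b \<otimes>\<^bsub>B\<^esub> j d)"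
      using M.group_centerD(1)[OF c g.hom_closed[OF b]] jd b by simp
    moreover have "inj_on g (carrier B)" using emb by (simp add: strong_embedding_def)
    ultimately show ?thesis using jd b by (blast dest: inj_onD)
  qed
  then show ?thesis using jd by (simp add: group_center_def)
qed

text \<open>The problem is symmetric in \<open>A\<close> and \<open>B\<close>, so the lemmas on
  amalgams are stated for one side only.\<close>

lemma strong_embedding_swap:
  assumes "strong_embedding A B D i j M f g"
  shows "strong_embedding B A D j i M g f"
proof -
  have "f ` i ` carrier D = g ` j ` carrier D"
    unfolding image_image using assms by (intro image_cong) (auto simp: strong_embedding_def)
  then show ?thesis using assms by (simp add: strong_embedding_def Int_commute)
qed

lemma amalgam_swap: "amalgam A B D i j \<Longrightarrow> amalgam B A D j i"
  by (auto simp: amalgam_def)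

text \<open>The factor \<open>u\<close> in \<open>A'\<close> becomes central in \<open>M\<close> and
  drops out, and \<open>d\<close> belongs to \<open>B\<close> as well; so the commutator is computed
  inside \<open>B\<close>.\<close>

lemma amalgam_commutator_reduce:
  assumes am: "amalgam A B D i j" and M: "class2_group M" and emb: "strong_embedding A B D i j M f g"
    and h: "h \<in> derived A (carrier A) <#>\<^bsub>A\<^esub> i ` carrier D" and b: "b \<in> carrier B"
  obtains u d where "h = u \<otimes>\<^bsub>A\<^esub> i d" "u \<in> derived A (carrier A)" "d \<in> carrier D"
    "commutator M (f h) (g b) = g (commutator B (j d) b)"
proof -
  interpret M: class2_group M by fact
  interpret A: group A using am by (simp add: amalgam_def)
  have f: "group_hom A M f" and g: "group_hom B M g"
    using emb am M.is_group by (auto simp: strong_embedding_def amalgam_def group_hom_def group_hom_axioms_def)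
  interpret f: group_hom A M f by fact
  interpret g: group_hom B M g by fact
  obtain u d where h: "h = u \<otimes>\<^bsub>A\<^esub> i d" "u \<in> derived A (carrier A)" "d \<in> carrier D"
    using h by (auto simp: set_mult_def)
  have uA: "u \<in> carrier A" using h(2) A.derived_in_carrier[of "carrier A"] by auto
  have ij: "i d \<in> carrier A" "j d \<in> carrier B" using am h(3) by (auto simp: amalgam_def hom_def)
  have "commutator M (f h) (g b) = commutator M (f u) (g b) \<otimes>\<^bsub>M\<^esub> commutator M (f (i d)) (g b)"
    using h uA ij b by (simp add: M.commutator_mult_left)
  also have "commutator M (f u) (g b) = \<one>\<^bsub>M\<^esub>"
    using M.group_centerD(1)[OF M.hom_derived_central[OF f h(2)]] uA b
    by (subst M.commutator_eq_one_iff) auto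
  also have "f (i d) = g (j d)" using emb h(3) by (simp add: strong_embedding_def)
  finally have "commutator M (f h) (g b) = g (commutator B (j d) b)"
    using ij b by (simp add: hom_commutator[OF g])
  then show thesis using that h by blast
qed

text \<open>Lets the pairing \<open>[a, b]\<^sup>n\<close> descend to \<open>A/A'D\<close>: the
  reduced commutator lies in \<open>B\<close>, which satisfies the identity for
  \<open>n\<close>.\<close>

lemma amalgam_commutator_pow_one:
  assumes am: "amalgam A B D i j" and M: "class2_group M" and emb: "strong_embedding A B D i j M f g"
    and B: "in_variety m n B"
    and h: "h \<in> derived A (carrier A) <#>\<^bsub>A\<^esub> i ` carrier D" and b: "b \<in> carrier B"
  shows "commutator M (f h) (g b) [^]\<^bsub>M\<^esub> n = \<one>\<^bsub>M\<^esub>"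
proof -
  interpret M: class2_group M by fact
  have g: "group_hom B M g"
    using emb am M.is_group by (auto simp: strong_embedding_def amalgam_def group_hom_def group_hom_axioms_def)
  interpret g: group_hom B M g by fact
  obtain u d where d: "d \<in> carrier D" "commutator M (f h) (g b) = g (commutator B (j d) b)"
    by (rule amalgam_commutator_reduce[OF am M emb h b])
  have "j d \<in> carrier B" using am d by (auto simp: amalgam_def hom_def)
  then show ?thesis
    using B b g.hom_nat_pow[of "commutator B (j d) b" n] by (simp add: d in_variety_def)
qed

text \<open>The point where the centrality conditions act. If \<open>a\<^sup>n = u d\<close> with
  \<open>u\<close> in \<open>A'\<close>, then \<open>d\<close> lies in \<open>A\<^sup>nA'\<close>
  and so is central in \<open>B\<close>; hence
  \<open>[a, b]\<^sup>n = [a\<^sup>n, b] = [d, b]\<close> is trivial.\<close>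

lemma amalgam_commutator_torsion:
  assumes am: "amalgam A B D i j" and M: "class2_group M" and emb: "strong_embedding A B D i j M f g"
    and A: "class2_group A"
    and cen: "\<And>d. d \<in> carrier D \<Longrightarrow> i d \<in> power_subgroup A n <#>\<^bsub>A\<^esub> derived A (carrier A) \<Longrightarrow> j d \<in> group_center B"
    and a: "a \<in> carrier A" "a [^]\<^bsub>A\<^esub> n \<in> derived A (carrier A) <#>\<^bsub>A\<^esub> i ` carrier D" and b: "b \<in> carrier B"
  shows "commutator M (f a) (g b) [^]\<^bsub>M\<^esub> n = \<one>\<^bsub>M\<^esub>"
proof -
  interpret M: class2_group M by fact
  interpret A: class2_group A by fact
  interpret B: group B using am by (simp add: amalgam_def)
  have f: "group_hom A M f" and g: "group_hom B M g"
    using emb am M.is_group by (auto simp: strong_embedding_def amalgam_def group_hom_def group_hom_axioms_def)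
  interpret f: group_hom A M f by fact
  interpret g: group_hom B M g by fact
  obtain u d where d: "a [^]\<^bsub>A\<^esub> n = u \<otimes>\<^bsub>A\<^esub> i d" "u \<in> derived A (carrier A)" "d \<in> carrier D"
      "commutator M (f (a [^]\<^bsub>A\<^esub> n)) (g b) = g (commutator B (j d) b)"
    by (rule amalgam_commutator_reduce[OF am M emb a(2) b])
  have ij: "i d \<in> carrier A" "j d \<in> carrier B" using am d by (auto simp: amalgam_def hom_def)
  have uc: "u \<in> group_center A" using A.derived_subset_center d(2) by auto
  have uA: "u \<in> carrier A" using A.group_centerD(2)[OF uc] .
  have "a [^]\<^bsub>A\<^esub> n \<otimes>\<^bsub>A\<^esub> inv\<^bsub>A\<^esub> u = i d"
    unfolding d(1) A.group_centerD(1)[OF uc ij(1)] using uA ij by (simp add: A.m_assoc)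
  moreover have "inv\<^bsub>A\<^esub> u \<in> derived A (carrier A)"
    using A.derived_is_subgroup[of "carrier A"] d(2) by (simp add: subgroup.m_inv_closed)
  moreover have "a [^]\<^bsub>A\<^esub> n \<in> power_subgroup A n"
    using a(1) by (auto simp: power_subgroup_def intro!: generate.incl)
  ultimately have "i d \<in> power_subgroup A n <#>\<^bsub>A\<^esub> derived A (carrier A)"
    unfolding set_mult_def by blast
  then have "j d \<in> group_center B" using cen d(3) by blast
  then have "commutator B (j d) b = \<one>\<^bsub>B\<^esub>"
    using B.group_centerD(1)[of "j d" b] ij b by (simp add: B.commutator_eq_one_iff)
  moreover have "commutator M (f a) (g b) [^]\<^bsub>M\<^esub> n = commutator M (f (a [^]\<^bsub>A\<^esub> n)) (g b)"
    using a b by (simp add: M.commutator_pow_left f.hom_nat_pow)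
  ultimately show ?thesis using d(4) by simp
qed


section \<open>Construction of the embedding into the variety\<close>

lemma strongly_embeddable_in_varietyI:
  fixes m n :: nat
    and A :: "('a, 'x) monoid_scheme"
    and B :: "('b, 'y) monoid_scheme"
    and D :: "('d, 'z) monoid_scheme"
    and i :: "'d \<Rightarrow> 'a" and j :: "'d \<Rightarrow> 'b"
    and M :: "('c, 'w) monoid_scheme"
  assumes mn: "n dvd m div gcd 2 m" and am: "amalgam A B D i j"
    and A: "in_variety m n A" and B: "in_variety m n B"
    and M: "in_N2 M" and emb: "strong_embedding A B D i j M f g"
    and cenB: "\<And>d. d \<in> carrier D \<Longrightarrow>
      i d \<in> power_subgroup A n <#>\<^bsub>A\<^esub> derived A (carrier A) \<Longrightarrow> j d \<in> group_center B"
    and cenA: "\<And>d. d \<in> carrier D \<Longrightarrow>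
      j d \<in> power_subgroup B n <#>\<^bsub>B\<^esub> derived B (carrier B) \<Longrightarrow> i d \<in> group_center A"
  shows "strongly_embeddable (in_variety m n) A B D i j"
proof -
  note am' = amalgam_swap[OF am] and emb' = strong_embedding_swap[OF emb]
  have M2: "class2_group M" and A2: "class2_group A" and B2: "class2_group B"
    using M A B by (simp_all add: in_N2_iff_class2_group[symmetric] in_variety_def in_N2_def)
  interpret M: class2_group M by fact
  interpret A: class2_group A by fact
  interpret B: class2_group B by fact
  interpret f: group_hom A M f
    using emb A.is_group M.is_group by (simp add: strong_embedding_def group_hom_def group_hom_axioms_def)
  interpret g: group_hom B M g
    using emb B.is_group M.is_group by (simp add: strong_embedding_def group_hom_def group_hom_axioms_def)
  interpret i: group_hom D A i
    using am by (simp add: amalgam_def group_hom_def group_hom_axioms_def)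
  interpret j: group_hom D B j
    using am by (simp add: amalgam_def group_hom_def group_hom_axioms_def)

  define N where "N = derived A (carrier A) <#>\<^bsub>A\<^esub> i ` carrier D"
  define N' where "N' = derived B (carrier B) <#>\<^bsub>B\<^esub> j ` carrier D"
  have "subgroup N A"
    unfolding N_def using i.img_is_subgroup
    by (intro A.mult_norm_subgroup A.derived_self_is_normal)
  moreover have "derived A (carrier A) \<subseteq> N"
  proof
    fix u assume u: "u \<in> derived A (carrier A)"
    then have "u = u \<otimes>\<^bsub>A\<^esub> i \<one>\<^bsub>D\<^esub>"
      using A.derived_in_carrier[of "carrier A"] by auto
    then show "u \<in> N" unfolding N_def set_mult_def using u i.G.one_closed by blast
  qed
  ultimately have N: "N \<lhd> A" "comm_group (A Mod N)"
    by (rule A.supergroup_derived_normal)+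
  have "subgroup N' B"
    unfolding N'_def using j.img_is_subgroup
    by (intro B.mult_norm_subgroup B.derived_self_is_normal)
  moreover have "derived B (carrier B) \<subseteq> N'"
  proof
    fix u assume u: "u \<in> derived B (carrier B)"
    then have "u = u \<otimes>\<^bsub>B\<^esub> j \<one>\<^bsub>D\<^esub>"
      using B.derived_in_carrier[of "carrier B"] by auto
    then show "u \<in> N'" unfolding N'_def set_mult_def using u i.G.one_closed by blast
  qed
  ultimately have N': "N' \<lhd> B" "comm_group (B Mod N')"
    by (rule B.supergroup_derived_normal)+
  interpret N: normal N A by (rule N)
  interpret N': normal N' B by (rule N')
  define X where "X = A Mod N"
  define Y where "Y = B Mod N'"
  interpret X: comm_group X unfolding X_def by (rule N)
  interpret Y: comm_group Y unfolding Y_def by (rule N')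
  have iN: "i d \<in> N" if "d \<in> carrier D" for d
    unfolding N_def set_mult_def
    using that subgroup.one_closed[OF A.derived_is_subgroup[of "carrier A"]] i.hom_closed[OF that]
    by (auto intro!: bexI[of _ "\<one>\<^bsub>A\<^esub>"] bexI[of _ d])
  have jN: "j d \<in> N'" if "d \<in> carrier D" for d
    unfolding N'_def set_mult_def
    using that subgroup.one_closed[OF B.derived_is_subgroup[of "carrier B"]] j.hom_closed[OF that]
    by (auto intro!: bexI[of _ "\<one>\<^bsub>B\<^esub>"] bexI[of _ d])

  define ZM where "ZM = M\<lparr>carrier := group_center M\<rparr>"
  interpret ZM: comm_group ZM unfolding ZM_def by (rule M.comm_group_group_center)
  define \<kappa> where "\<kappa> a b = commutator M (f a) (g b) [^]\<^bsub>M\<^esub> n" for a b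
  have kc: "\<kappa> a b \<in> group_center M" if "a \<in> carrier A" "b \<in> carrier B" for a b
    unfolding \<kappa>_def using that M.commutator_central[of "f (a [^]\<^bsub>A\<^esub> n)" "g b"]
    by (simp add: f.hom_nat_pow M.commutator_pow_left)
  have kl: "\<kappa> (a \<otimes>\<^bsub>A\<^esub> a') b = \<kappa> a b \<otimes>\<^bsub>M\<^esub> \<kappa> a' b"
    if "a \<in> carrier A" "a' \<in> carrier A" "b \<in> carrier B" for a a' b
    unfolding \<kappa>_def using that
    by (simp add: M.commutator_mult_left M.pow_mult_distrib[OF M.commutator_comm])
  have kr: "\<kappa> a (b \<otimes>\<^bsub>B\<^esub> b') = \<kappa> a b \<otimes>\<^bsub>M\<^esub> \<kappa> a b'"
    if "a \<in> carrier A" "b \<in> carrier B" "b' \<in> carrier B" for a b b'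
    unfolding \<kappa>_def using that
    by (simp add: M.commutator_mult_right M.pow_mult_distrib[OF M.commutator_comm])
  \<comment> \<open>The swapped amalgam yields statements about \<open>[g b, f a]\<close>, the
    inverse of the commutator in \<open>\<kappa>\<close>.\<close>
  have ksw: "\<kappa> a b = \<one>\<^bsub>M\<^esub>" if "commutator M (g b) (f a) [^]\<^bsub>M\<^esub> n = \<one>\<^bsub>M\<^esub>" "a \<in> carrier A" "b \<in> carrier B" for a b
    using that M.commutator_swap[of "g b" "f a"] by (simp add: \<kappa>_def M.nat_pow_inv)
  obtain \<beta> where \<beta>: "bihom X Y ZM \<beta>"
    and \<beta>_val: "\<And>a b. a \<in> carrier A \<Longrightarrow> b \<in> carrier B \<Longrightarrow> \<beta> (N #>\<^bsub>A\<^esub> a) (N' #>\<^bsub>B\<^esub> b) = \<kappa> a b"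
  proof (rule bihom_FactGroup[OF N N' ZM.comm_group_axioms, of \<kappa>])
    fix b assume "b \<in> carrier B"
    then show "(\<lambda>a. \<kappa> a b) \<in> hom A ZM" by (auto simp: hom_def ZM_def kc kl)
  next
    fix a assume "a \<in> carrier A"
    then show "\<kappa> a \<in> hom B ZM" by (auto simp: hom_def ZM_def kc kr)
  next
    fix a b assume "a \<in> N" "b \<in> carrier B"
    then show "\<kappa> a b = \<one>\<^bsub>ZM\<^esub>"
      using amalgam_commutator_pow_one[OF am M2 emb B] by (simp add: \<kappa>_def N_def ZM_def)
  next
    fix a b assume "a \<in> carrier A" "b \<in> N'"
    then show "\<kappa> a b = \<one>\<^bsub>ZM\<^esub>"
      using amalgam_commutator_pow_one[OF am' M2 emb' A] ksw by (simp add: N'_def[symmetric] ZM_def)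
  qed (auto simp: X_def Y_def)

  have "bihom_torsion X Y ZM \<beta> n"
  proof (intro bihom_torsion.intro bihom_torsion_axioms.intro \<beta>)
    fix x y assume xy: "x \<in> carrier X" "y \<in> carrier Y"
    then obtain a b where ab: "a \<in> carrier A" "b \<in> carrier B" "x = N #>\<^bsub>A\<^esub> a" "y = N' #>\<^bsub>B\<^esub> b"
      by (auto simp: X_def Y_def carrier_FactGroup)
    show "\<beta> x y = \<one>\<^bsub>ZM\<^esub>" if "x [^]\<^bsub>X\<^esub> n = \<one>\<^bsub>X\<^esub>"
    proof -
      have "N #>\<^bsub>A\<^esub> (a [^]\<^bsub>A\<^esub> n) = N" using that ab by (simp add: X_def N.FactGroup_pow)
      then have "a [^]\<^bsub>A\<^esub> n \<in> N" using A.coset_join1[OF _ _ N.is_subgroup] ab by simp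
      then have "\<kappa> a b = \<one>\<^bsub>M\<^esub>"
        using amalgam_commutator_torsion[OF am M2 emb A2 cenB ab(1) _ ab(2)]
        by (simp add: \<kappa>_def N_def)
      then show ?thesis using ab by (simp add: \<beta>_val ZM_def)
    qed
    show "\<beta> x y = \<one>\<^bsub>ZM\<^esub>" if "y [^]\<^bsub>Y\<^esub> n = \<one>\<^bsub>Y\<^esub>"
    proof -
      have "N' #>\<^bsub>B\<^esub> (b [^]\<^bsub>B\<^esub> n) = N'" using that ab by (simp add: Y_def N'.FactGroup_pow)
      then have "b [^]\<^bsub>B\<^esub> n \<in> N'" using B.coset_join1[OF _ _ N'.is_subgroup] ab by simp
      then have "\<kappa> a b = \<one>\<^bsub>M\<^esub>"
        using amalgam_commutator_torsion[OF am' M2 emb' B2 cenA ab(2) _ ab(1)] ksw ab(1,2)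
        by (simp add: N'_def)
      then show ?thesis using ab by (simp add: \<beta>_val ZM_def)
    qed
  qed
  then obtain W :: "('c \<times> ('a set \<times> 'b set \<Rightarrow>\<^sub>0 int)) set monoid" and \<iota> \<theta>
    where W: "in_N2 W" and \<iota>: "\<iota> \<in> hom M W" "inj_on \<iota> (carrier M)"
      and \<theta>: "bihom X Y (W\<lparr>carrier := group_center W\<rparr>) \<theta>"
      and root: "\<And>x y. x \<in> carrier X \<Longrightarrow> y \<in> carrier Y \<Longrightarrow> \<theta> x y [^]\<^bsub>W\<^esub> n = \<iota> (\<beta> x y)"
    using bihom_torsion_root[OF M, folded ZM_def] by blast
  interpret W: class2_group W using W by (simp add: in_N2_iff_class2_group)
  interpret iota: group_hom M W \<iota>
    using \<iota> by (simp add: group_hom_def group_hom_axioms_def M.is_group W.is_group)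
  interpret th: bihom X Y "W\<lparr>carrier := group_center W\<rparr>" \<theta> by (rule \<theta>)
  have thc: "\<theta> x y \<in> group_center W" if "x \<in> carrier X" "y \<in> carrier Y" for x y
    using th.closed[OF that] by simp
  have thW: "\<theta> x y \<in> carrier W" if "x \<in> carrier X" "y \<in> carrier Y" for x y
    using W.group_centerD(2)[OF thc[OF that]] .
  have th1: "\<theta> \<one>\<^bsub>X\<^esub> y = \<one>\<^bsub>W\<^esub>" if "y \<in> carrier Y" for y
    using hom_one[OF th.hom_left[OF that] X.is_group th.C.is_group] by simp
  have th2: "\<theta> x \<one>\<^bsub>Y\<^esub> = \<one>\<^bsub>W\<^esub>" if "x \<in> carrier X" for x
    using hom_one[OF th.hom_right[OF that] Y.is_group th.C.is_group] by simp

  \<comment> \<open>The factors \<open>X\<close> and \<open>Y\<close> store the cosets on which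
    \<open>\<theta>\<close> depends. Values of \<open>\<omega>\<close> have trivial coordinates
    there, which makes \<open>\<omega>\<close> trivial on its own values.\<close>
  define G where "G = W \<times>\<times> (X \<times>\<times> Y)"
  define \<omega> where
    "\<omega> p q = (inv\<^bsub>W\<^esub> \<theta> (fst (snd p)) (snd (snd q)), \<one>\<^bsub>X\<^esub>, \<one>\<^bsub>Y\<^esub>)"
    for p q :: "('c \<times> ('a set \<times> 'b set \<Rightarrow>\<^sub>0 int)) set \<times> 'a set \<times> 'b set"
  have G: "class2_group G"
    unfolding in_N2_iff_class2_group[symmetric] G_def
    by (intro in_N2_DirProd W comm_group_in_N2 X.comm_group_axioms Y.comm_group_axioms)
  interpret G: class2_group G by (rule G)
  have inv_mult_th: "inv\<^bsub>W\<^esub> (a \<otimes>\<^bsub>W\<^esub> b) = inv\<^bsub>W\<^esub> a \<otimes>\<^bsub>W\<^esub> inv\<^bsub>W\<^esub> b"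
    if "a \<in> group_center W" "b \<in> group_center W" for a b
    using W.inv_mult_group[of b a] W.group_centerD(1)[OF that(1)] W.group_centerD(2) that by auto
  have "twisting G \<omega>"
  proof (intro twisting.intro twisting_axioms.intro G)
    fix p q assume pq: "p \<in> carrier G" "q \<in> carrier G"
    have c: "inv\<^bsub>W\<^esub> \<theta> (fst (snd p)) (snd (snd q)) \<in> group_center W"
      using pq thc by (auto simp: G_def intro!: subgroup.m_inv_closed[OF W.group_center_subgroup])
    show "\<omega> p q \<in> group_center G"
      unfolding group_center_def \<omega>_def
      using W.group_centerD[OF c] by (auto simp: G_def)
  next
    fix p q r assume "p \<in> carrier G" "q \<in> carrier G" "r \<in> carrier G"
    then obtain w1 x1 y1 w2 x2 y2 w3 x3 y3 where
      p: "p = (w1, x1, y1)" "w1 \<in> carrier W" "x1 \<in> carrier X" "y1 \<in> carrier Y" and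
      q: "q = (w2, x2, y2)" "w2 \<in> carrier W" "x2 \<in> carrier X" "y2 \<in> carrier Y" and
      r: "r = (w3, x3, y3)" "w3 \<in> carrier W" "x3 \<in> carrier X" "y3 \<in> carrier Y"
      by (auto simp: G_def)
    show "\<omega> (p \<otimes>\<^bsub>G\<^esub> q) r = \<omega> p r \<otimes>\<^bsub>G\<^esub> \<omega> q r"
      using p q r th.mult_left[of x1 x2 y3] by (simp add: G_def \<omega>_def inv_mult_th thc)
    show "\<omega> p (q \<otimes>\<^bsub>G\<^esub> r) = \<omega> p q \<otimes>\<^bsub>G\<^esub> \<omega> p r"
      using p q r th.mult_right[of x1 y2 y3] by (simp add: G_def \<omega>_def inv_mult_th thc)
    show "\<omega> (\<omega> p q) r = \<one>\<^bsub>G\<^esub>" "\<omega> r (\<omega> p q) = \<one>\<^bsub>G\<^esub>"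
      using p q r by (simp_all add: G_def \<omega>_def th1 th2)
  qed
  then interpret T: twisting G \<omega> .
  define T where "T = T.twisted"
  interpret T2: class2_group T unfolding T_def by (rule T.twisted_class2_group)

  have NX: "N #>\<^bsub>A\<^esub> a \<in> carrier X" if "a \<in> carrier A" for a
    using that by (auto simp: X_def carrier_FactGroup)
  have NY: "N' #>\<^bsub>B\<^esub> b \<in> carrier Y" if "b \<in> carrier B" for b
    using that by (auto simp: Y_def carrier_FactGroup)
  \<comment> \<open>Elements of \<open>A\<close> have trivial \<open>Y\<close>-coordinate and
    elements of \<open>B\<close> trivial \<open>X\<close>-coordinate. So \<open>\<omega>\<close>
    vanishes within \<open>A\<close>, within \<open>B\<close> and on pairs \<open>(b, a)\<close>;
    only pairs \<open>(a, b)\<close> are twisted.\<close>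
  define f' where "f' a = (\<iota> (f a), N #>\<^bsub>A\<^esub> a, \<one>\<^bsub>Y\<^esub>)" for a
  define g' where "g' b = (\<iota> (g b), \<one>\<^bsub>X\<^esub>, N' #>\<^bsub>B\<^esub> b)" for b
  have f'G: "f' a \<in> carrier G" if "a \<in> carrier A" for a
    using that NX by (simp add: f'_def G_def)
  have g'G: "g' b \<in> carrier G" if "b \<in> carrier B" for b
    using that NY by (simp add: g'_def G_def)
  have f'hom: "f' \<in> hom A T"
    unfolding T_def
  proof (rule T.twisted_hom)
    show "f' \<in> hom A G"
      by (rule homI) (auto simp: f'G, simp add: f'_def G_def X_def N.rcos_sum)
  qed (use NX in \<open>simp add: f'_def \<omega>_def G_def th2\<close>)
  have g'hom: "g' \<in> hom B T"
    unfolding T_def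
  proof (rule T.twisted_hom)
    show "g' \<in> hom B G"
      by (rule homI) (auto simp: g'G, simp add: g'_def G_def Y_def N'.rcos_sum)
  qed (use NY in \<open>simp add: g'_def \<omega>_def G_def th1\<close>)
  interpret f': group_hom A T f'
    using f'hom by (simp add: group_hom_def group_hom_axioms_def A.is_group T2.is_group)
  interpret g': group_hom B T g'
    using g'hom by (simp add: group_hom_def group_hom_axioms_def B.is_group T2.is_group)

  \<comment> \<open>The commutator becomes \<open>\<iota> [a, b]\<close> times the inverse of
    \<open>\<theta> x y\<close>, and both factors have \<open>n\<close>-th powers given by
    \<open>\<iota> (\<beta> x y)\<close>, up to inversion.\<close>
  have mixed: "commutator T (f' a) (g' b) [^]\<^bsub>T\<^esub> n = \<one>\<^bsub>T\<^esub>" if ab: "a \<in> carrier A" "b \<in> carrier B" for a b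
  proof -
    define x where "x = N #>\<^bsub>A\<^esub> a"
    define y where "y = N' #>\<^bsub>B\<^esub> b"
    define c where "c = commutator M (f a) (g b)"
    have x: "x \<in> carrier X" and y: "y \<in> carrier Y" using ab NX NY by (auto simp: x_def y_def)
    have c: "c \<in> carrier M" using ab by (simp add: c_def)
    have "commutator G (f' a) (g' b) = (\<iota> c, \<one>\<^bsub>X\<^esub>, \<one>\<^bsub>Y\<^esub>)"
    proof (rule G.commutator_eqI)
      have "g b \<otimes>\<^bsub>M\<^esub> f a \<otimes>\<^bsub>M\<^esub> c = f a \<otimes>\<^bsub>M\<^esub> g b"
        using ab by (simp add: c_def M.mult_commutator)
      then have "\<iota> (g b) \<otimes>\<^bsub>W\<^esub> \<iota> (f a) \<otimes>\<^bsub>W\<^esub> \<iota> c = \<iota> (f a) \<otimes>\<^bsub>W\<^esub> \<iota> (g b)"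
        using ab c by (simp add: iota.hom_mult[symmetric] del: iota.hom_mult)
      then show "g' b \<otimes>\<^bsub>G\<^esub> f' a \<otimes>\<^bsub>G\<^esub> (\<iota> c, \<one>\<^bsub>X\<^esub>, \<one>\<^bsub>Y\<^esub>) = f' a \<otimes>\<^bsub>G\<^esub> g' b"
        using x y by (simp add: G_def f'_def g'_def x_def[symmetric] y_def[symmetric])
    qed (use ab f'G g'G c in \<open>auto simp: G_def\<close>)
    moreover have "\<omega> (f' a) (g' b) = (inv\<^bsub>W\<^esub> \<theta> x y, \<one>\<^bsub>X\<^esub>, \<one>\<^bsub>Y\<^esub>)"
      by (simp add: \<omega>_def f'_def g'_def x_def y_def)
    moreover have "\<omega> (g' b) (f' a) = \<one>\<^bsub>G\<^esub>"
      by (simp add: \<omega>_def f'_def g'_def th1) (simp add: G_def)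
    ultimately have "commutator T (f' a) (g' b) = (\<iota> c \<otimes>\<^bsub>W\<^esub> inv\<^bsub>W\<^esub> \<theta> x y, \<one>\<^bsub>X\<^esub>, \<one>\<^bsub>Y\<^esub>)"
      using ab f'G g'G x y c thW by (simp add: T_def T.twisted_commutator) (simp add: G_def)
    moreover have "(w, \<one>\<^bsub>X\<^esub>, \<one>\<^bsub>Y\<^esub>) [^]\<^bsub>G\<^esub> k = (w [^]\<^bsub>W\<^esub> k, \<one>\<^bsub>X\<^esub>, \<one>\<^bsub>Y\<^esub>)" for w and k :: nat
      by (induction k) (simp_all add: G_def)
    ultimately have "commutator T (f' a) (g' b) [^]\<^bsub>T\<^esub> n
        = ((\<iota> c \<otimes>\<^bsub>W\<^esub> inv\<^bsub>W\<^esub> \<theta> x y) [^]\<^bsub>W\<^esub> n, \<one>\<^bsub>X\<^esub>, \<one>\<^bsub>Y\<^esub>)"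
      using T.twisted_commutator_pow[OF f'G[OF ab(1)] g'G[OF ab(2)], of n] by (simp add: T_def)
    moreover have "(\<iota> c \<otimes>\<^bsub>W\<^esub> inv\<^bsub>W\<^esub> \<theta> x y) [^]\<^bsub>W\<^esub> n = \<iota> c [^]\<^bsub>W\<^esub> n \<otimes>\<^bsub>W\<^esub> inv\<^bsub>W\<^esub> \<theta> x y [^]\<^bsub>W\<^esub> n"
      using c x y thW W.group_centerD(1)[OF subgroup.m_inv_closed[OF W.group_center_subgroup thc[OF x y]]]
      by (intro W.pow_mult_distrib) auto
    moreover have "\<iota> c [^]\<^bsub>W\<^esub> n = \<theta> x y [^]\<^bsub>W\<^esub> n"
      using root[OF x y] \<beta>_val[OF ab] c
      by (simp add: x_def[symmetric] y_def[symmetric] \<kappa>_def c_def[symmetric] iota.hom_nat_pow)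
    moreover have "\<one>\<^bsub>T\<^esub> = (\<one>\<^bsub>W\<^esub>, \<one>\<^bsub>X\<^esub>, \<one>\<^bsub>Y\<^esub>)" by (simp add: T_def) (simp add: G_def)
    ultimately show ?thesis
      using thW[OF x y] by (simp add: W.nat_pow_inv)
  qed
  define S where "S = f' ` carrier A \<union> g' ` carrier B"
  have ST: "S \<subseteq> carrier T" by (auto simp: S_def)
  have "in_variety m n (T\<lparr>carrier := generate T S\<rparr>)"
  proof (rule T2.in_variety_generate[OF ST mn])
    fix s assume "s \<in> S"
    then show "s [^]\<^bsub>T\<^esub> m = \<one>\<^bsub>T\<^esub>"
      using A B by (auto simp: S_def in_variety_def f'.hom_nat_pow[symmetric] g'.hom_nat_pow[symmetric])
  next
    have same: "commutator T (f' a) (f' a') [^]\<^bsub>T\<^esub> n = \<one>\<^bsub>T\<^esub>" if "a \<in> carrier A" "a' \<in> carrier A" for a a'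
      using A that f'.hom_nat_pow[of "commutator A a a'" n]
      by (simp add: in_variety_def hom_commutator[OF f'.group_hom_axioms])
    have same': "commutator T (g' b) (g' b') [^]\<^bsub>T\<^esub> n = \<one>\<^bsub>T\<^esub>" if "b \<in> carrier B" "b' \<in> carrier B" for b b'
      using B that g'.hom_nat_pow[of "commutator B b b'" n]
      by (simp add: in_variety_def hom_commutator[OF g'.group_hom_axioms])
    have mixed': "commutator T (g' b) (f' a) [^]\<^bsub>T\<^esub> n = \<one>\<^bsub>T\<^esub>" if "a \<in> carrier A" "b \<in> carrier B" for a b
      using mixed[OF that] that T2.commutator_swap[of "f' a" "g' b"] by (simp add: T2.nat_pow_inv)
    fix s t assume "s \<in> S" "t \<in> S"
    then show "commutator T s t [^]\<^bsub>T\<^esub> n = \<one>\<^bsub>T\<^esub>"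
      using mixed mixed' same same' by (auto simp: S_def)
  qed
  moreover have "strong_embedding A B D i j (T\<lparr>carrier := generate T S\<rparr>) f' g'"
    unfolding strong_embedding_def
  proof (intro conjI ballI)
    have gen: "s \<in> generate T S" if "s \<in> S" for s using that by (rule generate.incl)
    show "f' \<in> hom A (T\<lparr>carrier := generate T S\<rparr>)"
      using f'hom gen by (auto simp: hom_def S_def)
    show "g' \<in> hom B (T\<lparr>carrier := generate T S\<rparr>)"
      using g'hom gen by (auto simp: hom_def S_def)
    have inj: "inj_on (\<iota> \<circ> f) (carrier A)" "inj_on (\<iota> \<circ> g) (carrier B)"
      using emb by (auto simp: strong_embedding_def intro!: comp_inj_on inj_on_subset[OF \<iota>(2)])
    show "inj_on f' (carrier A)" "inj_on g' (carrier B)"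
      using inj by (auto simp: inj_on_def f'_def g'_def)
    \<comment> \<open>\<open>i d\<close> lies in \<open>N\<close> and \<open>j d\<close> in
      \<open>N'\<close>, so all coset coordinates are trivial and only the common image in
      \<open>M\<close> remains.\<close>
    show agree: "f' (i d) = g' (j d)" if d: "d \<in> carrier D" for d
      using emb d A.coset_join2[OF _ N.is_subgroup iN[OF d]] B.coset_join2[OF _ N'.is_subgroup jN[OF d]]
      by (simp add: f'_def g'_def strong_embedding_def X_def Y_def)
    show "f' ` carrier A \<inter> g' ` carrier B = f' ` i ` carrier D"
    proof
      show "f' ` carrier A \<inter> g' ` carrier B \<subseteq> f' ` i ` carrier D"
      proof
        fix t assume "t \<in> f' ` carrier A \<inter> g' ` carrier B"
        then obtain a b where ab: "a \<in> carrier A" "b \<in> carrier B" "t = f' a" "f' a = g' b" by auto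
        \<comment> \<open>The first coordinate still contains the whole embedding into
          \<open>M\<close>, so an element common to both images already comes from the intersection
          in \<open>M\<close>.\<close>
        then have "f a = g b" using inj_onD[OF \<iota>(2), of "f a" "g b"] by (simp add: f'_def g'_def)
        then have "f a \<in> f ` i ` carrier D" using emb ab(1,2) unfolding strong_embedding_def by blast
        then obtain d where d: "d \<in> carrier D" "f a = f (i d)" by auto
        then have "a = i d"
          using emb ab(1) i.hom_closed[OF d(1)] unfolding strong_embedding_def by (blast dest: inj_onD)
        then show "t \<in> f' ` i ` carrier D" using ab(3) d(1) by blast
      qed
      show "f' ` i ` carrier D \<subseteq> f' ` carrier A \<inter> g' ` carrier B"
        using agree by auto
    qed
  qed
  ultimately show ?thesis
    by (rule strongly_embeddable_varietyI[OF A.is_group B.is_group])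
qed

theorem theorem4p2:
  fixes m n :: nat
    and A :: "('a, 'x) monoid_scheme"
    and B :: "('b, 'y) monoid_scheme"
    and D :: "('d, 'z) monoid_scheme"
    and i :: "'d \<Rightarrow> 'a" and j :: "'d \<Rightarrow> 'b"
  assumes "n dvd m div gcd 2 m"
    and "amalgam A B D i j"
    and "in_variety m n A" and "in_variety m n B" and "in_variety m n D"
  shows "strongly_embeddable (in_variety m n) A B D i j \<longleftrightarrow>
           strongly_embeddable in_N2 A B D i j \<and>
           (\<forall>d \<in> carrier D.
              i d \<in> power_subgroup A n <#>\<^bsub>A\<^esub> derived A (carrier A) \<longrightarrow> j d \<in> group_center B) \<and>
           (\<forall>d \<in> carrier D.
              j d \<in> power_subgroup B n <#>\<^bsub>B\<^esub> derived B (carrier B) \<longrightarrow> i d \<in> group_center A)"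
proof
  assume "strongly_embeddable (in_variety m n) A B D i j"
  then obtain M :: "('a + 'b) list monoid" and f g
    where M: "in_variety m n M" and emb: "strong_embedding A B D i j M f g"
    unfolding strongly_embeddable_def by blast
  \<comment> \<open>The same \<open>M\<close> serves for class two, and the second inclusion is the
    first one for the swapped amalgam.\<close>
  have "in_N2 M" using M by (simp add: in_variety_def in_N2_def)
  then show "strongly_embeddable in_N2 A B D i j \<and>
           (\<forall>d \<in> carrier D.
              i d \<in> power_subgroup A n <#>\<^bsub>A\<^esub> derived A (carrier A) \<longrightarrow> j d \<in> group_center B) \<and>
           (\<forall>d \<in> carrier D.
              j d \<in> power_subgroup B n <#>\<^bsub>B\<^esub> derived B (carrier B) \<longrightarrow> i d \<in> group_center A)"
    using emb strongly_embeddable_imp_central[OF assms(2) M emb]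
      strongly_embeddable_imp_central[OF amalgam_swap[OF assms(2)] M strong_embedding_swap[OF emb]]
    unfolding strongly_embeddable_def by blast
next
  assume R: "strongly_embeddable in_N2 A B D i j \<and>
           (\<forall>d \<in> carrier D.
              i d \<in> power_subgroup A n <#>\<^bsub>A\<^esub> derived A (carrier A) \<longrightarrow> j d \<in> group_center B) \<and>
           (\<forall>d \<in> carrier D.
              j d \<in> power_subgroup B n <#>\<^bsub>B\<^esub> derived B (carrier B) \<longrightarrow> i d \<in> group_center A)"
  then obtain M :: "('a + 'b) list monoid" and f g
    where "in_N2 M" "strong_embedding A B D i j M f g"
    unfolding strongly_embeddable_def by blast
  then show "strongly_embeddable (in_variety m n) A B D i j"
    using strongly_embeddable_in_varietyI[OF assms(1-4)] R by blast
qed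

end
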